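(* Two words $w,w'$ in $A$ can be reduced to the same (abstract) word if and only if $r(w\restriction I)=r(w'\restriction I)$ for every finite $I\subseteq\mathbb N$.
   Context: $\mathbb N=\{0,1,2,\dots\}$. Let $\{\vec e_0,\vec e_1,\dots\}$ and $\{\overleftarrow{e}_0,\overleftarrow{e}_1,\dots\}$ be disjoint countably infinite sets and let $A$ be their union. Elements of $A$ are letters; $\vec e_i$ and $\overleftarrow{e}_i$ are inverse to each other. For $I\subseteq\mathbb N$ let $A_I=\{\vec e_i\mid i\in I\}\cup\{\overleftarrow{e}_i\mid i\in I\}$. A word in $A$ is a map $w\colon S\to A$ from a totally ordered countable set $S$ (the set of positions of $w$) such that $w^{-1}(a)$ is finite for every $a\in A$; it is finite or infinite according to whether $S$ is. Words $w\colon S\to A$ and $w'\colon S'\to A$ are considered the same (as abstract words) if $w=w'\circ\varphi$ for an order-preserving bijection $\varphi\colon S\to S'$. Write $w\restriction I$ for the restriction of $w$ to $w^{-1}(A_I)$; for finite $I$ this is a finite word. Two elements of a totally ordered set are adjacent in it if no element of the set lies strictly between them. A reduction of a word $w\colon S\to A$ is a totally ordered set $R$ of disjoint 2-element subsets of $S$ such that the two elements of each $p\in R$ are adjacent in $S\setminus\bigcup\{q\in R\mid q<p\}$ and are mapped by $w$ to inverse letters $\vec e_i,\overleftarrow{e}_i$. We then say that $w$ reduces to the word $w\restriction(S\setminus\bigcup R)$. A word is reduced if it has no nonempty reduction. Every finite word $v$ reduces to a unique reduced word (unique as an abstract word), denoted $r(v)$. *)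

theory Defs
  imports "HOL-Library.Countable_Set"
begin

datatype letter = Fwd nat | Bwd nat

primrec inv_letter :: "letter \<Rightarrow> letter" where
  "inv_letter (Fwd i) = Bwd i"
| "inv_letter (Bwd i) = Fwd i"

definition letters :: "nat set \<Rightarrow> letter set" where
  "letters I = Fwd ` I \<union> Bwd ` I"

text \<open>A map from a totally ordered set of positions to letters. The order is the reflexive one,
  as a relation on the positions; values of \<open>letter_at\<close> outside \<open>positions\<close> are irrelevant.\<close>

record 'a word =
  positions :: "'a set"
  pos_le :: "'a rel"
  letter_at :: "'a \<Rightarrow> letter"

definition is_word :: "'a word \<Rightarrow> bool" where
  "is_word w \<longleftrightarrow>
     countable (positions w) \<and>
     linear_order_on (positions w) (pos_le w) \<and>
     (\<forall>a. finite {s \<in> positions w. letter_at w s = a})"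

text \<open>Equality of abstract words. The position types may differ.\<close>

definition same_word :: "'a word \<Rightarrow> 'b word \<Rightarrow> bool" where
  "same_word w w' \<longleftrightarrow>
     (\<exists>\<phi>. bij_betw \<phi> (positions w) (positions w') \<and>
          (\<forall>x \<in> positions w. \<forall>y \<in> positions w.
             (x, y) \<in> pos_le w \<longleftrightarrow> (\<phi> x, \<phi> y) \<in> pos_le w') \<and>
          (\<forall>x \<in> positions w. letter_at w x = letter_at w' (\<phi> x)))"

definition restrict_word :: "'a word \<Rightarrow> 'a set \<Rightarrow> 'a word" where
  "restrict_word w T =
     \<lparr>positions = positions w \<inter> T,
      pos_le = Restr (pos_le w) (positions w \<inter> T),
      letter_at = letter_at w\<rparr>"

definition restrict_letters :: "'a word \<Rightarrow> nat set \<Rightarrow> 'a word" where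
  "restrict_letters w I = restrict_word w {s \<in> positions w. letter_at w s \<in> letters I}"

definition adjacent_in :: "'a rel \<Rightarrow> 'a set \<Rightarrow> 'a \<Rightarrow> 'a \<Rightarrow> bool" where
  "adjacent_in le T x y \<longleftrightarrow>
     x \<in> T \<and> y \<in> T \<and>
     \<not> (\<exists>z \<in> T. z \<noteq> x \<and> z \<noteq> y \<and>
          ((x, z) \<in> le \<and> (z, y) \<in> le \<or> (y, z) \<in> le \<and> (z, x) \<in> le))"

text \<open>\<open>R\<close> is the set of cancelled pairs and \<open>le\<close> the (reflexive) total order on it, in which the
  pairs are cancelled; this order may have any order type.\<close>

definition reduction :: "'a word \<Rightarrow> 'a set set \<Rightarrow> 'a set rel \<Rightarrow> bool" where
  "reduction w R le \<longleftrightarrow>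
     linear_order_on R le \<and>
     pairwise disjnt R \<and>
     (\<forall>p \<in> R. \<exists>x y. p = {x, y} \<and> x \<noteq> y \<and> x \<in> positions w \<and> y \<in> positions w \<and>
        adjacent_in (pos_le w) (positions w - \<Union>{q \<in> R. (q, p) \<in> le \<and> q \<noteq> p}) x y \<and>
        letter_at w y = inv_letter (letter_at w x))"

definition reduces_to :: "'a word \<Rightarrow> 'a word \<Rightarrow> bool" where
  "reduces_to w u \<longleftrightarrow>
     (\<exists>R le. reduction w R le \<and> u = restrict_word w (positions w - \<Union>R))"

definition reduced :: "'a word \<Rightarrow> bool" where
  "reduced w \<longleftrightarrow> (\<forall>R le. reduction w R le \<longrightarrow> R = {})"

text \<open>The reduced form \<open>r(v)\<close> of a finite word \<open>v\<close>. It is unique only as an abstract word, so this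
  picks a representative, to be compared with other words by \<^const>\<open>same_word\<close>.\<close>

definition red_form :: "'a word \<Rightarrow> 'a word" where
  "red_form v = (SOME u. reduces_to v u \<and> reduced u)"

end

theory Submission
  imports Defs "HOL-Library.FuncSet"
begin

text \<open>Draw each cancelled pair of a reduction as an arc over the word. The arcs do not cross, and
  no surviving position lies under an arc; conversely every such family of arcs, joining positions
  with inverse letters, can be cancelled in the order of the right endpoints. So the order on the
  cancelled pairs can be forgotten, and a reduction is the same thing as a noncrossing
  \<^emph>\<open>pairing\<close> (\<open>reduces_to_iff_pairing\<close>).

  As in a group, two words should be equivalent iff \<open>w\<close> followed by the inverse of \<open>w'\<close> cancels
  completely. In this quotient word the arcs inside \<open>w\<close> and inside the inverse of \<open>w'\<close> reduce
  the two words, while the arcs from \<open>w\<close> to \<open>w'\<close> match the surviving positions, and being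
  noncrossing makes this matching an isomorphism of orders. Hence \<open>w\<close> and \<open>w'\<close> reduce to the
  same word iff the quotient word has a pairing of all its positions
  (\<open>common_reduction_iff_quotient_pairing\<close>).

  That a map is a pairing of all positions is a condition on its values at finitely many positions
  at a time. Only finitely many positions carry a given letter, and a partner must carry the
  inverse letter, so every position has finitely many candidates for its partner. By compactness a
  word has a total pairing iff all its restrictions to finitely many letters have one
  (\<open>total_pairing_compactness\<close>). Restricting letters commutes with forming the quotient word, so
  \<open>w\<close> and \<open>w'\<close> have a common reduction iff \<open>w \<restriction> I\<close> and \<open>w' \<restriction> I\<close> have one for every finite \<open>I\<close>.

  For the finite words \<open>w \<restriction> I\<close> and \<open>w' \<restriction> I\<close> a common reduction exists iff the reduced forms
  agree, by uniqueness of the reduced form (\<open>same_red_form_iff_common_reduction\<close>). That is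
  shown by computing the reduced form letter by letter on the list that spells the word: the
  result of this computation is invariant under reductions.\<close>

section \<open>Positions, letters and restrictions\<close>

lemma position_refl:
  "linear_order_on (positions v) (pos_le v) \<Longrightarrow> x \<in> positions v \<Longrightarrow> (x, x) \<in> pos_le v"
  by (simp add: order_on_defs refl_on_def)

lemma position_trans:
  "linear_order_on (positions v) (pos_le v) \<Longrightarrow> (x, y) \<in> pos_le v \<Longrightarrow> (y, z) \<in> pos_le v
    \<Longrightarrow> (x, z) \<in> pos_le v"
  unfolding order_on_defs by (blast dest: transD)

lemma position_antisym:
  "linear_order_on (positions v) (pos_le v) \<Longrightarrow> (x, y) \<in> pos_le v \<Longrightarrow> (y, x) \<in> pos_le v \<Longrightarrow> x = y"
  unfolding order_on_defs by (blast dest: antisymD)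

lemma position_total:
  "linear_order_on (positions v) (pos_le v) \<Longrightarrow> x \<in> positions v \<Longrightarrow> y \<in> positions v
    \<Longrightarrow> (x, y) \<in> pos_le v \<or> (y, x) \<in> pos_le v"
  unfolding order_on_defs refl_on_def total_on_def by (cases "x = y") auto

lemma position_field:
  "linear_order_on (positions v) (pos_le v) \<Longrightarrow> (x, y) \<in> pos_le v \<Longrightarrow> x \<in> positions v \<and> y \<in> positions v"
  unfolding order_on_defs by blast

lemma inv_letter_inv_letter [simp]: "inv_letter (inv_letter a) = a"
  by (cases a) auto

lemma inv_letter_neq [simp]: "inv_letter a \<noteq> a" "a \<noteq> inv_letter a"
  by (cases a; simp)+

lemma inv_letter_eq_iff [simp]: "inv_letter a = inv_letter b \<longleftrightarrow> a = b"
  by (metis inv_letter_inv_letter)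

lemma inv_letter_in_letters [simp]: "inv_letter a \<in> letters I \<longleftrightarrow> a \<in> letters I"
  by (cases a) (auto simp: letters_def)

lemma linear_order_restrict_word:
  assumes "linear_order_on (positions v) (pos_le v)"
  shows "linear_order_on (positions (restrict_word v T)) (pos_le (restrict_word v T))"
  using assms unfolding restrict_word_def order_on_defs
  by (auto simp: refl_on_def total_on_def antisym_def intro: trans_Restr)

lemma restrict_word_simps [simp]:
  "positions (restrict_word v T) = positions v \<inter> T"
  "(x, y) \<in> pos_le (restrict_word v T) \<longleftrightarrow>
     (x, y) \<in> pos_le v \<and> x \<in> positions v \<inter> T \<and> y \<in> positions v \<inter> T"
  "letter_at (restrict_word v T) = letter_at v"
  by (auto simp: restrict_word_def)

lemma restrict_letters_simps [simp]:
  "positions (restrict_letters v I) = {s \<in> positions v. letter_at v s \<in> letters I}"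
  "(x, y) \<in> pos_le (restrict_letters v I) \<longleftrightarrow>
     (x, y) \<in> pos_le v \<and> x \<in> positions (restrict_letters v I) \<and> y \<in> positions (restrict_letters v I)"
  "letter_at (restrict_letters v I) = letter_at v"
  by (auto simp: restrict_letters_def)

lemma finite_positions_restrict_letters:
  assumes "is_word v" "finite I"
  shows "finite (positions (restrict_letters v I))"
proof -
  have "positions (restrict_letters v I) = (\<Union>a \<in> letters I. {s \<in> positions v. letter_at v s = a})"
    by auto
  then show ?thesis
    using assms by (auto simp: is_word_def letters_def)
qed

lemma linear_order_restrict_letters:
  assumes "linear_order_on (positions v) (pos_le v)"
  shows "linear_order_on (positions (restrict_letters v I)) (pos_le (restrict_letters v I))"
  unfolding restrict_letters_def using assms by (rule linear_order_restrict_word)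

section \<open>Reductions as noncrossing pairings\<close>

text \<open>An involution \<open>f\<close> on the set \<open>D\<close> of cancelled positions; \<open>x\<close> and \<open>f x\<close> are the ends of an
  arc. The last clause says that \<open>f\<close> maps every interval \<open>[x, f x]\<close> into itself, so that arcs are
  nested or disjoint and nothing under an arc survives. It is vacuous if \<open>x\<close> is the right end
  of its arc. With non-strict inequalities the two ends satisfy it by themselves, which saves case
  distinctions.\<close>

definition pairing :: "'a word \<Rightarrow> 'a set \<Rightarrow> ('a \<Rightarrow> 'a) \<Rightarrow> bool" where
  "pairing v D f \<longleftrightarrow> D \<subseteq> positions v \<and>
     (\<forall>x \<in> D. f x \<in> D \<and> f (f x) = x \<and> letter_at v (f x) = inv_letter (letter_at v x)) \<and>
     (\<forall>x \<in> D. \<forall>z. (x, z) \<in> pos_le v \<and> (z, f x) \<in> pos_le v \<longrightarrow>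
        z \<in> D \<and> (x, f z) \<in> pos_le v \<and> (f z, f x) \<in> pos_le v)"

lemma pairingD:
  assumes "pairing v D f" "x \<in> D"
  shows "x \<in> positions v" "f x \<in> D" "f (f x) = x"
    "letter_at v (f x) = inv_letter (letter_at v x)" "f x \<noteq> x"
proof -
  have "D \<subseteq> positions v"
    and "\<forall>x \<in> D. f x \<in> D \<and> f (f x) = x \<and> letter_at v (f x) = inv_letter (letter_at v x)"
    using assms(1) unfolding pairing_def by blast+
  then show "x \<in> positions v" "f x \<in> D" "f (f x) = x"
    and inverse: "letter_at v (f x) = inv_letter (letter_at v x)"
    using assms(2) by (fast, fast, fast, fast)
  show "f x \<noteq> x" using inverse inv_letter_neq by metis
qed

lemma pairing_interval:
  assumes "pairing v D f" "x \<in> D" "(x, z) \<in> pos_le v" "(z, f x) \<in> pos_le v"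
  shows "z \<in> D" "(x, f z) \<in> pos_le v" "(f z, f x) \<in> pos_le v"
proof -
  have "\<forall>x \<in> D. \<forall>z. (x, z) \<in> pos_le v \<and> (z, f x) \<in> pos_le v \<longrightarrow>
        z \<in> D \<and> (x, f z) \<in> pos_le v \<and> (f z, f x) \<in> pos_le v"
    using assms(1) unfolding pairing_def by blast
  from bspec[OF this assms(2), THEN spec, THEN mp, OF conjI, OF assms(3,4)]
  show "z \<in> D" "(x, f z) \<in> pos_le v" "(f z, f x) \<in> pos_le v" by blast+
qed

lemma pairingI:
  assumes "D \<subseteq> positions v"
    and "\<And>x. x \<in> D \<Longrightarrow> f x \<in> D" "\<And>x. x \<in> D \<Longrightarrow> f (f x) = x"
    and "\<And>x. x \<in> D \<Longrightarrow> letter_at v (f x) = inv_letter (letter_at v x)"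
    and "\<And>x z. x \<in> D \<Longrightarrow> (x, z) \<in> pos_le v \<Longrightarrow> (z, f x) \<in> pos_le v
      \<Longrightarrow> z \<in> D \<and> (x, f z) \<in> pos_le v \<and> (f z, f x) \<in> pos_le v"
  shows "pairing v D f"
  unfolding pairing_def
proof (intro conjI[OF assms(1)] conjI ballI allI impI; (erule conjE)?)
  fix x assume x: "x \<in> D"
  show "f x \<in> D" "f (f x) = x" "letter_at v (f x) = inv_letter (letter_at v x)"
    using assms(2-4)[OF x] by this+
  fix z assume z: "(x, z) \<in> pos_le v" "(z, f x) \<in> pos_le v"
  show "z \<in> D" "(x, f z) \<in> pos_le v" "(f z, f x) \<in> pos_le v"
    using assms(5)[OF x z] by blast+
qed

text \<open>A position \<open>z\<close> under the arc of \<open>x\<close> must have been cancelled before that arc. If the partner of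
  \<open>z\<close> were outside the arc, one end of the arc of \<open>x\<close> would lie under the arc of \<open>z\<close> and would
  have to be cancelled before it: a contradiction, whatever the order type of the reduction.\<close>

lemma pairing_of_reduction:
  assumes lin: "linear_order_on (positions v) (pos_le v)" and red: "reduction v R le"
  obtains f where "pairing v (\<Union>R) f"
proof -
  define below where "below p = {q \<in> R. (q, p) \<in> le \<and> q \<noteq> p}" for p
  have le: "linear_order_on R le" and dis: "pairwise disjnt R"
    using red by (auto simp: reduction_def)
  have same: "p = q" if "p \<in> R" "q \<in> R" "x \<in> p" "x \<in> q" for p q x
    using dis that by (auto simp: pairwise_def disjnt_def)
  define P where "P x y \<longleftrightarrow> {x, y} \<in> R \<and> y \<noteq> x \<and> x \<in> positions v \<and>
    letter_at v y = inv_letter (letter_at v x) \<and>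
    adjacent_in (pos_le v) (positions v - \<Union>(below {x, y})) x y" for x y
  have "\<exists>y. P x y" if x: "x \<in> \<Union>R" for x
  proof -
    obtain p where p: "p \<in> R" "x \<in> p" using x by blast
    obtain a b where ab: "p = {a, b}" "a \<noteq> b" "a \<in> positions v" "b \<in> positions v"
      "adjacent_in (pos_le v) (positions v - \<Union>(below p)) a b"
      "letter_at v b = inv_letter (letter_at v a)"
      using red p(1) unfolding reduction_def below_def by blast
    have "P a b"
      unfolding P_def ab(1)[symmetric] using p(1) ab(2-) by blast
    moreover have "adjacent_in (pos_le v) (positions v - \<Union>(below p)) b a"
      using ab(5) unfolding adjacent_in_def by blast
    moreover have "{b, a} = p" using ab(1) by blast
    ultimately have "P a b" "P b a"
      using p(1) ab(2-4,6) unfolding P_def by simp_all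
    then show ?thesis using p(2) ab(1) by blast
  qed
  then obtain f where f: "\<And>x. x \<in> \<Union>R \<Longrightarrow> P x (f x)" by metis
  have f_in: "f x \<in> \<Union>R" and f_pair: "{x, f x} \<in> R" and f_neq: "f x \<noteq> x" if "x \<in> \<Union>R" for x
    using f[OF that] by (auto simp: P_def)
  have ff: "f (f x) = x" if x: "x \<in> \<Union>R" for x
  proof -
    have "{f x, f (f x)} = {x, f x}"
      using same[of "{f x, f (f x)}" "{x, f x}" "f x"] f_pair f_in x by blast
    then show ?thesis using f_neq f_in x by (auto simp: doubleton_eq_iff)
  qed
  have pos: "\<Union>R \<subseteq> positions v" using f by (auto simp: P_def)
  \<comment> \<open>A position under an arc belongs to an arc that was cancelled earlier.\<close>
  have under: "z \<in> \<Union>R \<and> ({z, f z}, {x, f x}) \<in> le \<and> {z, f z} \<noteq> {x, f x}"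
    if x: "x \<in> \<Union>R" and z: "z \<noteq> x" "z \<noteq> f x"
      "(x, z) \<in> pos_le v \<and> (z, f x) \<in> pos_le v \<or> (f x, z) \<in> pos_le v \<and> (z, x) \<in> pos_le v"
    for x z
  proof -
    have "z \<in> positions v" using z(3) position_field[OF lin] by blast
    then have "z \<in> \<Union>(below {x, f x})"
      using f[OF x] z unfolding P_def adjacent_in_def by blast
    then obtain q where q: "q \<in> R" "(q, {x, f x}) \<in> le" "q \<noteq> {x, f x}" "z \<in> q"
      by (auto simp: below_def)
    then have "z \<in> \<Union>R" by blast
    moreover have "q = {z, f z}" using same[OF q(1) f_pair q(4)] \<open>z \<in> \<Union>R\<close> by blast
    ultimately show ?thesis using q by blast
  qed
  have antisym: "p = q" if "(p, q) \<in> le" "(q, p) \<in> le" for p q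
    using le that unfolding linear_order_on_def partial_order_on_def by (blast dest: antisymD)
  have "z \<in> \<Union>R \<and> (x, f z) \<in> pos_le v \<and> (f z, f x) \<in> pos_le v"
    if x: "x \<in> \<Union>R" and z: "(x, z) \<in> pos_le v" "(z, f x) \<in> pos_le v" for x z
  proof (cases "z = x \<or> z = f x")
    case True
    then show ?thesis
      using x z f_in[OF x] ff[OF x] pos position_refl[OF lin] by auto
  next
    case False
    then have zR: "z \<in> \<Union>R" and lt: "({z, f z}, {x, f x}) \<in> le" "{z, f z} \<noteq> {x, f x}"
      using under[OF x, of z] z by blast+
    have fz: "f z \<noteq> x" "f z \<noteq> f x" using False ff[OF zR] ff[OF x] by metis+
    have gt: "\<not> (({x, f x}, {z, f z}) \<in> le)" using antisym lt by blast
    have in_pos: "x \<in> positions v" "f x \<in> positions v" "f z \<in> positions v"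
      using pos x f_in[OF x] f_in[OF zR] by blast+
    have "(x, f z) \<in> pos_le v"
    proof (rule ccontr)
      assume "(x, f z) \<notin> pos_le v"
      then have "(f z, x) \<in> pos_le v" using position_total[OF lin] in_pos by blast
      then show False using under[OF zR, of x] z(1) False fz gt by blast
    qed
    moreover have "(f z, f x) \<in> pos_le v"
    proof (rule ccontr)
      assume "(f z, f x) \<notin> pos_le v"
      then have "(f x, f z) \<in> pos_le v" using position_total[OF lin] in_pos by blast
      then have "({f x, f (f x)}, {z, f z}) \<in> le"
        using under[OF zR, of "f x"] z(2) False fz by metis
      then show False using gt ff[OF x] by (simp add: insert_commute)
    qed
    ultimately show ?thesis using zR by blast
  qed
  moreover have "letter_at v (f x) = inv_letter (letter_at v x)" if "x \<in> \<Union>R" for x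
    using f[OF that] by (simp add: P_def)
  ultimately have "pairing v (\<Union>R) f"
    using pos f_in ff by (intro pairingI)
  then show thesis by (rule that)
qed

text \<open>Cancel the arcs in the order of their right endpoints. This is a linear order on the arcs, and
  an arc nested inside another one has the smaller right endpoint.\<close>

lemma reduction_of_pairing:
  assumes lin: "linear_order_on (positions v) (pos_le v)" and pf: "pairing v D f"
  obtains R le where "reduction v R le" "\<Union>R = D"
proof -
  note refl = position_refl[OF lin] and trans = position_trans[OF lin]
    and antisym = position_antisym[OF lin] and total = position_total[OF lin]
  \<comment> \<open>\<open>E\<close> is the set of right endpoints, and \<open>g\<close> is injective on it.\<close>
  define E where "E = {x \<in> D. (f x, x) \<in> pos_le v}"
  define g where "g x = {x, f x}" for x
  define le where "le = {(g x, g y) | x y. x \<in> E \<and> y \<in> E \<and> (x, y) \<in> pos_le v}"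
  have ED: "E \<subseteq> D" by (auto simp: E_def)
  have DS: "D \<subseteq> positions v" using pairingD(1)[OF pf] by blast
  have g_inj: "x = y" if "x \<in> E" "y \<in> E" "g x = g y" for x y
    using that antisym by (fastforce simp: E_def g_def doubleton_eq_iff)
  have le_iff: "(g x, g y) \<in> le \<longleftrightarrow> (x, y) \<in> pos_le v" if xy: "x \<in> E" "y \<in> E" for x y
  proof
    assume "(g x, g y) \<in> le"
    then obtain x' y' where "g x = g x'" "g y = g y'" "x' \<in> E" "y' \<in> E" "(x', y') \<in> pos_le v"
      unfolding le_def by blast
    then show "(x, y) \<in> pos_le v" using g_inj[of x x'] g_inj[of y y'] xy by simp
  qed (use xy in \<open>auto simp: le_def\<close>)
  have g_partner: "g (f x) = g x" if "x \<in> D" for x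
    unfolding g_def pairingD(3)[OF pf that] by (rule insert_commute)
  have g_eq: "g s = g x" if "x \<in> D" "s \<in> g x" for x s
  proof -
    have "s = x \<or> s = f x" using that(2) by (simp add: g_def)
    then show ?thesis using g_partner[OF that(1)] by (elim disjE) simp_all
  qed
  have g_same: "g x = g y" if "x \<in> D" "y \<in> D" "s \<in> g x" "s \<in> g y" for x y s
    using g_eq[OF that(1,3)] g_eq[OF that(2,4)] by simp
  have cover: "\<exists>e \<in> E. z \<in> g e \<and> e \<in> {z, f z}" if "z \<in> D" for z
  proof (cases "(f z, z) \<in> pos_le v")
    case True
    then show ?thesis using that by (auto simp: E_def g_def)
  next
    case False
    then have "(z, f z) \<in> pos_le v" using total that DS pairingD[OF pf that] by blast
    then show ?thesis using pairingD[OF pf that] by (auto simp: E_def g_def)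
  qed
  have union: "\<Union>(g ` E) = D"
  proof
    show "\<Union>(g ` E) \<subseteq> D" using ED pairingD(2)[OF pf] by (auto simp: g_def)
    show "D \<subseteq> \<Union>(g ` E)" using cover by blast
  qed
  have order: "linear_order_on (g ` E) le"
    unfolding linear_order_on_def partial_order_on_def preorder_on_def
  proof (intro conjI)
    show "le \<subseteq> g ` E \<times> g ` E" by (auto simp: le_def)
    show "refl_on (g ` E) le"
      unfolding refl_on_def using refl ED DS le_iff by blast
    show "trans le"
    proof (rule transI)
      fix p q r assume "(p, q) \<in> le" "(q, r) \<in> le"
      then obtain x y y' z where *: "p = g x" "q = g y" "q = g y'" "r = g z"
        "x \<in> E" "y \<in> E" "y' \<in> E" "z \<in> E" "(x, y) \<in> pos_le v" "(y', z) \<in> pos_le v"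
        unfolding le_def by blast
      then have "y = y'" using g_inj by blast
      then show "(p, r) \<in> le" using * trans le_iff by blast
    qed
    show "antisym le"
    proof (rule antisymI)
      fix p q assume pq: "(p, q) \<in> le" "(q, p) \<in> le"
      then obtain x y where *: "p = g x" "q = g y" "x \<in> E" "y \<in> E"
        unfolding le_def by blast
      then have "(x, y) \<in> pos_le v" "(y, x) \<in> pos_le v" using pq le_iff by blast+
      then show "p = q" using antisym * by blast
    qed
    show "total_on (g ` E) le"
      unfolding total_on_def using total ED DS le_iff by blast
  qed
  have disjoint: "pairwise disjnt (g ` E)"
  proof (rule pairwiseI)
    fix p q assume pq: "p \<in> g ` E" "q \<in> g ` E" "p \<noteq> q"
    then obtain x y where xy: "p = g x" "q = g y" "x \<in> D" "y \<in> D" using ED by blast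
    then show "disjnt p q" using pq(3) g_same[of x y] by (auto simp: disjnt_def)
  qed
  have pairs: "\<exists>x y. p = {x, y} \<and> x \<noteq> y \<and> x \<in> positions v \<and> y \<in> positions v \<and>
      adjacent_in (pos_le v) (positions v - \<Union>{q \<in> g ` E. (q, p) \<in> le \<and> q \<noteq> p}) x y \<and>
      letter_at v y = inv_letter (letter_at v x)" if p: "p \<in> g ` E" for p
  proof -
    obtain x where x: "x \<in> E" "p = g x" using p by blast
    then have xD: "x \<in> D" and fx: "(f x, x) \<in> pos_le v" by (auto simp: E_def)
    note D = pairingD[OF pf xD] and fD = pairingD[OF pf pairingD(2)[OF pf xD]]
    let ?T = "positions v - \<Union>{q \<in> g ` E. (q, p) \<in> le \<and> q \<noteq> p}"
    have last: "x \<in> ?T" "f x \<in> ?T"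
      using D(1) fD(1) x(2) xD ED g_same[of x] by (auto simp: g_def)
    have nothing_under: "False" if z: "z \<in> ?T" "z \<noteq> x" "z \<noteq> f x" "(f x, z) \<in> pos_le v" "(z, x) \<in> pos_le v" for z
    proof -
      have zD: "z \<in> D" "(f z, x) \<in> pos_le v"
        using pairing_interval[OF pf D(2), of z] z D(3) by auto
      obtain e where e: "e \<in> E" "z \<in> g e" "e \<in> {z, f z}" using cover[OF zD(1)] by blast
      have "(e, x) \<in> pos_le v" using e(3) z(5) zD(2) by auto
      then have "(g e, p) \<in> le" using le_iff e x by blast
      moreover have "g e \<noteq> p" using e(2) z x by (auto simp: g_def)
      ultimately show False using z(1) e by blast
    qed
    have "(x, f x) \<notin> pos_le v" using antisym fx D(5) by blast
    then have not_above: "\<not> ((x, z) \<in> pos_le v \<and> (z, f x) \<in> pos_le v)" for z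
      using trans[of x z "f x"] by blast
    have adj: "adjacent_in (pos_le v) ?T x (f x)"
      unfolding adjacent_in_def
    proof (intro conjI last notI)
      assume "\<exists>z\<in>?T. z \<noteq> x \<and> z \<noteq> f x \<and> ((x, z) \<in> pos_le v \<and> (z, f x) \<in> pos_le v \<or>
        (f x, z) \<in> pos_le v \<and> (z, x) \<in> pos_le v)"
      then obtain z where "z \<in> ?T" "z \<noteq> x" "z \<noteq> f x" "(f x, z) \<in> pos_le v" "(z, x) \<in> pos_le v"
        using not_above by blast
      then show False by (rule nothing_under)
    qed
    have "p = {x, f x}" using x(2) unfolding g_def .
    with D(5)[symmetric] D(1,4) fD(1) adj show ?thesis by blast
  qed
  have "reduction v (g ` E) le"
    unfolding reduction_def by (rule conjI[OF order conjI[OF disjoint ballI[OF pairs]]])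
  then show thesis using union that by blast
qed

lemma reduces_to_iff_pairing:
  assumes "linear_order_on (positions v) (pos_le v)"
  shows "reduces_to v u \<longleftrightarrow> (\<exists>D f. pairing v D f \<and> u = restrict_word v (positions v - D))"
  unfolding reduces_to_def
proof
  assume "\<exists>R le. reduction v R le \<and> u = restrict_word v (positions v - \<Union>R)"
  then obtain R le where R: "reduction v R le" "u = restrict_word v (positions v - \<Union>R)" by blast
  from assms R(1) obtain f where "pairing v (\<Union>R) f" by (rule pairing_of_reduction)
  with R(2) show "\<exists>D f. pairing v D f \<and> u = restrict_word v (positions v - D)" by blast
next
  assume "\<exists>D f. pairing v D f \<and> u = restrict_word v (positions v - D)"
  then obtain D f where D: "pairing v D f" "u = restrict_word v (positions v - D)" by blast
  from assms D(1) obtain R le where "reduction v R le" "\<Union>R = D" by (rule reduction_of_pairing)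
  with D(2) show "\<exists>R le. reduction v R le \<and> u = restrict_word v (positions v - \<Union>R)" by blast
qed

text \<open>Both ends of an arc are on the same side of a surviving position, as that position cannot be
  under the arc.\<close>

lemma pairing_outside:
  assumes lin: "linear_order_on (positions v) (pos_le v)" and pf: "pairing v D f"
    and x: "x \<in> positions v" "x \<notin> D" and z: "z \<in> D"
  shows pairing_above: "(x, z) \<in> pos_le v \<Longrightarrow> (x, f z) \<in> pos_le v"
    and pairing_below: "(z, x) \<in> pos_le v \<Longrightarrow> (f z, x) \<in> pos_le v"
proof -
  note Z = pairingD[OF pf z]
  have total: "(x, f z) \<in> pos_le v \<or> (f z, x) \<in> pos_le v"
    using position_total[OF lin x(1) pairingD(1)[OF pf Z(2)]] .
  show "(x, f z) \<in> pos_le v" if "(x, z) \<in> pos_le v"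
    using total pairing_interval(1)[OF pf Z(2), of x] that x(2) unfolding Z(3) by blast
  show "(f z, x) \<in> pos_le v" if "(z, x) \<in> pos_le v"
    using total pairing_interval(1)[OF pf z that] x(2) by blast
qed

section \<open>Common reductions as total pairings\<close>

text \<open>The word \<open>w\<close> followed by the inverse of \<open>w'\<close>: the positions of \<open>w'\<close> come in reverse order and
  carry the inverse letters.\<close>

definition quotient_word :: "'a word \<Rightarrow> 'b word \<Rightarrow> ('a + 'b) word" where
  "quotient_word w w' =
     \<lparr>positions = positions w <+> positions w',
      pos_le = {(Inl x, Inl y) | x y. (x, y) \<in> pos_le w} \<union>
               {(Inr x, Inr y) | x y. (y, x) \<in> pos_le w'} \<union>
               {(Inl x, Inr y) | x y. x \<in> positions w \<and> y \<in> positions w'},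
      letter_at = case_sum (letter_at w) (\<lambda>y. inv_letter (letter_at w' y))\<rparr>"

lemma quotient_word_simps [simp]:
  "Inl x \<in> positions (quotient_word w w') \<longleftrightarrow> x \<in> positions w"
  "Inr y \<in> positions (quotient_word w w') \<longleftrightarrow> y \<in> positions w'"
  "(Inl x, Inl z) \<in> pos_le (quotient_word w w') \<longleftrightarrow> (x, z) \<in> pos_le w"
  "(Inr y, Inr t) \<in> pos_le (quotient_word w w') \<longleftrightarrow> (t, y) \<in> pos_le w'"
  "(Inl x, Inr y) \<in> pos_le (quotient_word w w') \<longleftrightarrow> x \<in> positions w \<and> y \<in> positions w'"
  "(Inr y, Inl x) \<notin> pos_le (quotient_word w w')"
  "letter_at (quotient_word w w') (Inl x) = letter_at w x"
  "letter_at (quotient_word w w') (Inr y) = inv_letter (letter_at w' y)"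
  by (auto simp: quotient_word_def)

lemma linear_order_quotient_word:
  assumes lin: "linear_order_on (positions w) (pos_le w)"
    and lin': "linear_order_on (positions w') (pos_le w')"
  shows "linear_order_on (positions (quotient_word w w')) (pos_le (quotient_word w w'))"
    (is "linear_order_on ?P ?le")
  unfolding linear_order_on_def partial_order_on_def preorder_on_def
proof (intro conjI)
  show "?le \<subseteq> ?P \<times> ?P"
  proof (rule subrelI)
    fix s t assume "(s, t) \<in> ?le"
    then show "(s, t) \<in> ?P \<times> ?P"
      using position_field[OF lin] position_field[OF lin'] by (cases s; cases t) auto
  qed
  show "refl_on ?P ?le"
  proof (unfold refl_on_def, rule ballI)
    fix s assume "s \<in> ?P"
    then show "(s, s) \<in> ?le"
      using position_refl[OF lin] position_refl[OF lin'] by (cases s) auto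
  qed
  show "trans ?le"
  proof (rule transI)
    fix r s t assume "(r, s) \<in> ?le" "(s, t) \<in> ?le"
    then show "(r, t) \<in> ?le"
      by (cases r; cases s; cases t; simp)
        (blast dest: position_trans[OF lin] position_trans[OF lin']
          position_field[OF lin] position_field[OF lin'])+
  qed
  show "antisym ?le"
  proof (rule antisymI)
    fix s t assume "(s, t) \<in> ?le" "(t, s) \<in> ?le"
    then show "s = t"
      using position_antisym[OF lin] position_antisym[OF lin'] by (cases s; cases t) auto
  qed
  show "total_on ?P ?le"
  proof (unfold total_on_def, intro ballI impI)
    fix s t assume "s \<in> ?P" "t \<in> ?P"
    then show "(s, t) \<in> ?le \<or> (t, s) \<in> ?le"
      using position_total[OF lin] position_total[OF lin'] by (cases s; cases t) auto
  qed
qed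

text \<open>Each surviving position of \<open>w\<close> is joined to the position of \<open>w'\<close> that the isomorphism \<open>\<phi>\<close>
  assigns to it. The reversal of the order of \<open>w'\<close> makes these arcs concentric, and by
  \<open>pairing_outside\<close> the arcs of the two reductions do not cross them.\<close>

lemma quotient_pairing_of_common_reduction:
  assumes lin: "linear_order_on (positions w) (pos_le w)"
    and lin': "linear_order_on (positions w') (pos_le w')"
    and pf: "pairing w D f" and pf': "pairing w' D' f'"
    and same: "same_word (restrict_word w (positions w - D)) (restrict_word w' (positions w' - D'))"
  shows "\<exists>F. pairing (quotient_word w w') (positions (quotient_word w w')) F"
proof -
  let ?Q = "quotient_word w w'"
  define U where "U = positions w - D"
  define U' where "U' = positions w' - D'"
  have US: "x \<in> positions w" "x \<notin> D" if "x \<in> U" for x using that by (auto simp: U_def)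
  have US': "y \<in> positions w'" "y \<notin> D'" if "y \<in> U'" for y using that by (auto simp: U'_def)
  have U_pos: "positions (restrict_word w U) = U" "positions (restrict_word w' U') = U'"
    by (auto simp: U_def U'_def)
  obtain \<phi> where bij: "bij_betw \<phi> U U'"
    and \<phi>_le: "\<forall>x\<in>U. \<forall>y\<in>U. (x, y) \<in> pos_le (restrict_word w U) \<longleftrightarrow>
                 (\<phi> x, \<phi> y) \<in> pos_le (restrict_word w' U')"
    and \<phi>_letter: "\<forall>x\<in>U. letter_at w x = letter_at w' (\<phi> x)"
    using same unfolding same_word_def U_def[symmetric] U'_def[symmetric] U_pos restrict_word_simps(3)
    by blast
  define \<psi> where "\<psi> = inv_into U \<phi>"
  have \<phi>: "\<phi> x \<in> U'" "\<psi> (\<phi> x) = x" if "x \<in> U" for x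
    using that bij bij_betw_inv_into_left[OF bij] by (auto simp: \<psi>_def bij_betw_def)
  have \<psi>: "\<psi> y \<in> U" "\<phi> (\<psi> y) = y" if "y \<in> U'" for y
    using that bij_betw_inv_into_right[OF bij] bij_betw_inv_into[OF bij]
    by (auto simp: \<psi>_def bij_betw_def)
  have mono: "(\<phi> x, \<phi> y) \<in> pos_le w' \<longleftrightarrow> (x, y) \<in> pos_le w" if "x \<in> U" "y \<in> U" for x y
    using \<phi>_le that \<phi>(1) US US' by simp
  define F where "F = case_sum (\<lambda>x. if x \<in> D then Inl (f x) else Inr (\<phi> x))
                               (\<lambda>y. if y \<in> D' then Inr (f' y) else Inl (\<psi> y))"
  have F_D: "F (Inl x) = Inl (f x)" if "x \<in> D" for x using that by (simp add: F_def)
  have F_U: "F (Inl x) = Inr (\<phi> x)" if "x \<in> U" for x using US(2)[OF that] by (simp add: F_def)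
  have F_D': "F (Inr y) = Inr (f' y)" if "y \<in> D'" for y using that by (simp add: F_def)
  have F_U': "F (Inr y) = Inl (\<psi> y)" if "y \<in> U'" for y using US'(2)[OF that] by (simp add: F_def)
  have F_cases: thesis
    if "s \<in> positions ?Q"
      and "\<And>x. s = Inl x \<Longrightarrow> x \<in> D \<Longrightarrow> thesis" "\<And>x. s = Inl x \<Longrightarrow> x \<in> U \<Longrightarrow> thesis"
      and "\<And>y. s = Inr y \<Longrightarrow> y \<in> D' \<Longrightarrow> thesis" "\<And>y. s = Inr y \<Longrightarrow> y \<in> U' \<Longrightarrow> thesis"
    for s thesis
    using that by (cases s) (auto simp: U_def U'_def)
  note D = pairingD[OF pf] and D' = pairingD[OF pf']
  have "pairing ?Q (positions ?Q) F"
  proof (rule pairingI)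
    fix s assume s: "s \<in> positions ?Q"
    show "F s \<in> positions ?Q"
      using s by (rule F_cases)
        (simp_all add: F_D F_U F_D' F_U' D(1)[OF D(2)] D'(1)[OF D'(2)] US(1)[OF \<psi>(1)] US'(1)[OF \<phi>(1)])
    show "F (F s) = s"
      using s by (rule F_cases)
        (simp_all add: F_D F_U F_D' F_U' D(2,3) D'(2,3) \<psi> \<phi>)
    show "letter_at ?Q (F s) = inv_letter (letter_at ?Q s)"
      using s by (rule F_cases)
        (simp_all add: F_D F_U F_D' F_U' D(4) D'(4) \<psi> \<phi>_letter)
    fix t assume t: "(s, t) \<in> pos_le ?Q" "(t, F s) \<in> pos_le ?Q"
    have tQ: "t \<in> positions ?Q"
      using position_field[OF linear_order_quotient_word[OF lin lin']] t(1) by blast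
    have "(s, F t) \<in> pos_le ?Q \<and> (F t, F s) \<in> pos_le ?Q"
      using s
    proof (rule F_cases)
      fix x assume x: "s = Inl x" "x \<in> D"
      then obtain z where z: "t = Inl z" "(x, z) \<in> pos_le w" "(z, f x) \<in> pos_le w"
        using t by (cases t) (simp_all add: F_D)
      show ?thesis
        using pairing_interval[OF pf x(2) z(2,3)] x z by (simp add: F_D)
    next
      fix y assume y: "s = Inr y" "y \<in> D'"
      then obtain z where z: "t = Inr z" "(z, y) \<in> pos_le w'" "(f' y, z) \<in> pos_le w'"
        using t by (cases t) (simp_all add: F_D')
      show ?thesis
        using pairing_interval[OF pf' D'(2)[OF y(2)] z(3), unfolded D'(3)[OF y(2)], OF z(2)] y z
        by (simp add: F_D')
    next
      fix y assume "s = Inr y" "y \<in> U'"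
      then show ?thesis using t by (cases t) (simp_all add: F_U')
    next
      fix x assume x: "s = Inl x" "x \<in> U"
      note xU = US[OF x(2)] and xU' = US'[OF \<phi>(1)[OF x(2)]]
      from tQ show ?thesis
      proof (rule F_cases)
        fix z assume z: "t = Inl z" "z \<in> D"
        then have "(x, f z) \<in> pos_le w"
          using pairing_above[OF lin pf xU z(2)] t x by simp
        then show ?thesis using x z xU' D(1)[OF D(2)[OF z(2)]] by (simp add: F_D F_U)
      next
        fix z assume z: "t = Inl z" "z \<in> U"
        then have "(\<phi> x, \<phi> z) \<in> pos_le w'" using mono x t by simp
        then show ?thesis using x z xU US'(1)[OF \<phi>(1)[OF z(2)]] by (simp add: F_U)
      next
        fix z assume z: "t = Inr z" "z \<in> D'"
        then have "(\<phi> x, f' z) \<in> pos_le w'"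
          using pairing_above[OF lin' pf' xU' z(2)] t x by (simp add: F_U)
        then show ?thesis using x z xU D'(1)[OF D'(2)[OF z(2)]] by (simp add: F_D' F_U)
      next
        fix z assume z: "t = Inr z" "z \<in> U'"
        then have "(x, \<psi> z) \<in> pos_le w"
          using mono[OF x(2) \<psi>(1)[OF z(2)]] \<psi>(2)[OF z(2)] t x by (simp add: F_U)
        then show ?thesis using x z xU' US(1)[OF \<psi>(1)[OF z(2)]] by (simp add: F_U F_U')
      qed
    qed
    then show "t \<in> positions ?Q \<and> (s, F t) \<in> pos_le ?Q \<and> (F t, F s) \<in> pos_le ?Q"
      using tQ by simp
  qed simp
  then show ?thesis by blast
qed

text \<open>The arcs of the quotient word are sorted by where their ends are: arcs with both ends in \<open>w\<close>
  reduce \<open>w\<close>, arcs with both ends in \<open>w'\<close> reduce \<open>w'\<close>, and the remaining arcs form the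
  isomorphism \<open>\<phi>\<close> between the results.\<close>

lemma common_reduction_of_quotient_pairing:
  assumes lin: "linear_order_on (positions w) (pos_le w)"
    and lin': "linear_order_on (positions w') (pos_le w')"
    and PF: "pairing (quotient_word w w') (positions (quotient_word w w')) F"
  obtains D f D' f' where "pairing w D f" "pairing w' D' f'"
    "same_word (restrict_word w (positions w - D)) (restrict_word w' (positions w' - D'))"
proof -
  let ?Q = "quotient_word w w'"
  define f where "f x = projl (F (Inl x))" for x
  define f' where "f' y = projr (F (Inr y))" for y
  define \<phi> where "\<phi> x = projr (F (Inl x))" for x
  define \<psi> where "\<psi> y = projl (F (Inr y))" for y
  define D where "D = {x \<in> positions w. isl (F (Inl x))}"
  define D' where "D' = {y \<in> positions w'. \<not> isl (F (Inr y))}"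
  have DS: "x \<in> positions w" if "x \<in> D" for x using that by (simp add: D_def)
  have DS': "y \<in> positions w'" if "y \<in> D'" for y using that by (simp add: D'_def)
  have F_D: "F (Inl x) = Inl (f x)" if "x \<in> D" for x
    using that by (simp add: D_def f_def)
  have F_U: "F (Inl x) = Inr (\<phi> x)" if "x \<in> positions w - D" for x
    using that by (simp add: D_def \<phi>_def)
  have F_D': "F (Inr y) = Inr (f' y)" if "y \<in> D'" for y
    using that by (simp add: D'_def f'_def)
  have F_U': "F (Inr y) = Inl (\<psi> y)" if "y \<in> positions w' - D'" for y
    using that by (simp add: D'_def \<psi>_def)
  have Q: "F s \<in> positions ?Q" "F (F s) = s" "letter_at ?Q (F s) = inv_letter (letter_at ?Q s)"
    if "s \<in> positions ?Q" for s
    using pairingD[OF PF that] by simp_all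
  have ivl: "(s, F t) \<in> pos_le ?Q" "(F t, F s) \<in> pos_le ?Q"
    if "s \<in> positions ?Q" "(s, t) \<in> pos_le ?Q" "(t, F s) \<in> pos_le ?Q" for s t
    using pairing_interval[OF PF that] by simp_all

  have "pairing w D f"
  proof (rule pairingI)
    show "D \<subseteq> positions w" using DS by blast
    fix x assume x: "x \<in> D"
    have sx: "Inl x \<in> positions ?Q" using DS[OF x] by simp
    have fx: "f x \<in> positions w" "F (Inl (f x)) = Inl x"
      "letter_at w (f x) = inv_letter (letter_at w x)"
      using Q[OF sx] by (simp_all add: F_D[OF x])
    then show "f x \<in> D" by (simp add: D_def)
    show "f (f x) = x" using fx(2) by (simp add: f_def)
    show "letter_at w (f x) = inv_letter (letter_at w x)" by (fact fx(3))
    fix z assume z: "(x, z) \<in> pos_le w" "(z, f x) \<in> pos_le w"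
    have *: "(Inl x, F (Inl z)) \<in> pos_le ?Q" "(F (Inl z), Inl (f x)) \<in> pos_le ?Q"
      using ivl[OF sx, of "Inl z"] z by (simp_all add: F_D[OF x])
    then obtain t where t: "F (Inl z) = Inl t" by (cases "F (Inl z)") simp_all
    have "z \<in> D" using position_field[OF lin z(1)] t by (simp add: D_def)
    then show "z \<in> D \<and> (x, f z) \<in> pos_le w \<and> (f z, f x) \<in> pos_le w"
      using * by (simp add: F_D)
  qed
  moreover have "pairing w' D' f'"
  proof (rule pairingI)
    show "D' \<subseteq> positions w'" using DS' by blast
    fix y assume y: "y \<in> D'"
    have sy: "Inr y \<in> positions ?Q" using DS'[OF y] by simp
    have fy: "f' y \<in> positions w'" "F (Inr (f' y)) = Inr y"
      "letter_at w' (f' y) = inv_letter (letter_at w' y)"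
      using Q(1,2)[OF sy] arg_cong[OF Q(3)[OF sy], of inv_letter] by (simp_all add: F_D'[OF y])
    then show "f' y \<in> D'" by (simp add: D'_def)
    show "f' (f' y) = y" using fy(2) by (simp add: f'_def)
    show "letter_at w' (f' y) = inv_letter (letter_at w' y)" by (fact fy(3))
    fix z assume z: "(y, z) \<in> pos_le w'" "(z, f' y) \<in> pos_le w'"
    have sfy: "Inr (f' y) \<in> positions ?Q" using fy(1) by simp
    have *: "(Inr (f' y), F (Inr z)) \<in> pos_le ?Q" "(F (Inr z), Inr y) \<in> pos_le ?Q"
      using ivl[OF sfy, of "Inr z"] z by (simp_all add: fy(2))
    then obtain t where t: "F (Inr z) = Inr t" by (cases "F (Inr z)") simp_all
    have "z \<in> D'" using position_field[OF lin' z(1)] t by (simp add: D'_def)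
    then show "z \<in> D' \<and> (y, f' z) \<in> pos_le w' \<and> (f' z, f' y) \<in> pos_le w'"
      using * by (simp add: F_D')
  qed
  moreover have "same_word (restrict_word w (positions w - D)) (restrict_word w' (positions w' - D'))"
  proof -
    define U where "U = positions w - D"
    define U' where "U' = positions w' - D'"
    have \<phi>: "\<phi> x \<in> U'" "\<psi> (\<phi> x) = x" "letter_at w x = letter_at w' (\<phi> x)" if x: "x \<in> U" for x
    proof -
      have sx: "Inl x \<in> positions ?Q" using x by (simp add: U_def)
      have F: "F (Inl x) = Inr (\<phi> x)" using F_U x by (simp add: U_def)
      have *: "\<phi> x \<in> positions w'" "F (Inr (\<phi> x)) = Inl x"
        using Q[OF sx] by (simp_all add: F)
      show "\<phi> x \<in> U'" using * by (simp add: U'_def D'_def)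
      show "\<psi> (\<phi> x) = x" using *(2) by (simp add: \<psi>_def)
      show "letter_at w x = letter_at w' (\<phi> x)" using Q(3)[OF sx] by (simp add: F)
    qed
    have \<psi>: "\<psi> y \<in> U" "\<phi> (\<psi> y) = y" if y: "y \<in> U'" for y
    proof -
      have sy: "Inr y \<in> positions ?Q" using y by (simp add: U'_def)
      have F: "F (Inr y) = Inl (\<psi> y)" using F_U' y by (simp add: U'_def)
      have *: "\<psi> y \<in> positions w" "F (Inl (\<psi> y)) = Inr y"
        using Q[OF sy] by (simp_all add: F)
      show "\<psi> y \<in> U" using * by (simp add: U_def D_def)
      show "\<phi> (\<psi> y) = y" using *(2) by (simp add: \<phi>_def)
    qed
    have "bij_betw \<phi> U U'"
      by (rule bij_betw_byWitness[where f' = \<psi>]) (use \<phi> \<psi> in blast)+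
    moreover have "(x, y) \<in> pos_le w \<longleftrightarrow> (\<phi> x, \<phi> y) \<in> pos_le w'" if x: "x \<in> U" and y: "y \<in> U" for x y
    proof -
      have sx: "Inl x \<in> positions ?Q" using x by (simp add: U_def)
      have Fx: "F (Inl x) = Inr (\<phi> x)" and Fy: "F (Inl y) = Inr (\<phi> y)"
        using F_U x y by (simp_all add: U_def)
      have Fy': "F (Inr (\<phi> y)) = Inl y"
        using F_U' \<phi>[OF y] by (simp add: U'_def)
      have pos: "x \<in> positions w" "y \<in> positions w" "\<phi> x \<in> positions w'" "\<phi> y \<in> positions w'"
        using x y \<phi>(1) by (auto simp: U_def U'_def)
      \<comment> \<open>If \<open>x \<le> y\<close>, then \<open>y\<close> lies under the arc of \<open>x\<close>, so \<open>\<phi> y\<close> does; and vice versa.\<close>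
      show ?thesis
        using ivl(2)[OF sx, of "Inl y"] ivl(1)[OF sx, of "Inr (\<phi> y)"] pos
        by (auto simp: Fx Fy Fy')
    qed
    ultimately have "same_word (restrict_word w U) (restrict_word w' U')"
      unfolding same_word_def using \<phi>(1,3)
      by (intro exI[of _ \<phi>]) (auto simp: U_def U'_def Int_absorb1)
    then show ?thesis by (simp add: U_def U'_def)
  qed
  ultimately show thesis by (rule that)
qed

lemma common_reduction_iff_quotient_pairing:
  assumes lin: "linear_order_on (positions w) (pos_le w)"
    and lin': "linear_order_on (positions w') (pos_le w')"
  shows "(\<exists>u u'. reduces_to w u \<and> reduces_to w' u' \<and> same_word u u') \<longleftrightarrow>
         (\<exists>F. pairing (quotient_word w w') (positions (quotient_word w w')) F)"
  unfolding reduces_to_iff_pairing[OF lin] reduces_to_iff_pairing[OF lin']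
proof
  assume "\<exists>F. pairing (quotient_word w w') (positions (quotient_word w w')) F"
  then obtain F where "pairing (quotient_word w w') (positions (quotient_word w w')) F" by blast
  from lin lin' this obtain D f D' f' where "pairing w D f" "pairing w' D' f'"
    "same_word (restrict_word w (positions w - D)) (restrict_word w' (positions w' - D'))"
    by (rule common_reduction_of_quotient_pairing)
  then show "\<exists>u u'. (\<exists>D f. pairing w D f \<and> u = restrict_word w (positions w - D)) \<and>
      (\<exists>D f. pairing w' D f \<and> u' = restrict_word w' (positions w' - D)) \<and> same_word u u'"
    by blast
qed (use quotient_pairing_of_common_reduction[OF lin lin'] in blast)

section \<open>Compactness\<close>

text \<open>A form of Koenig's infinity lemma. The restrictions of the maps \<open>f m\<close> to the finite set \<open>D n\<close> take
  only finitely many values for \<open>m \<ge> n\<close>, so one can successively pass to infinite sets \<open>A n\<close> of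
  indices on which these restrictions are constant.

  The limit \<open>g\<close> agrees on each \<open>D n\<close> with one of the given maps. Therefore \<open>g\<close> has every property
  that concerns finitely many arguments at a time and that each \<open>f m\<close> has on \<open>D m\<close>.\<close>

lemma finite_valued_limit:
  fixes f :: "nat \<Rightarrow> 'a \<Rightarrow> 'b"
  assumes fin: "\<And>n. finite (D n)" and mono: "\<And>m n. m \<le> n \<Longrightarrow> D m \<subseteq> D n"
    and finC: "\<And>x. finite (C x)" and val: "\<And>n x. x \<in> D n \<Longrightarrow> f n x \<in> C x"
  obtains g where "\<And>n. \<exists>m\<ge>n. \<forall>x\<in>D n. g x = f m x"
proof -
  define P where "P n A \<longleftrightarrow> infinite A \<and> (\<forall>i\<in>A. \<forall>j\<in>A. \<forall>x\<in>D n. f i x = f j x)" for n and A :: "nat set"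
  have refine: "\<exists>B. P n B \<and> B \<subseteq> A" if A: "infinite A" for n and A :: "nat set"
  proof -
    let ?A = "A \<inter> {n..}"
    let ?h = "\<lambda>m. restrict (f m) (D n)"
    have "A \<subseteq> ?A \<union> {..<n}" by auto
    then have "infinite ?A" using A finite_subset[of A "?A \<union> {..<n}"] by blast
    moreover have "?h m \<in> PiE (D n) C" if "m \<in> ?A" for m
      using val[of _ m] mono[of n m] that by auto
    then have "finite (?h ` ?A)"
      using finite_PiE[OF fin finC] by (meson finite_subset image_subsetI)
    ultimately obtain i where i: "i \<in> ?A" "infinite {m \<in> ?A. ?h m = ?h i}"
      using pigeonhole_infinite[of ?A ?h] by blast
    define N where "N = {m \<in> ?A. ?h m = ?h i}"
    have "f m x = f i x" if "m \<in> N" "x \<in> D n" for m x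
    proof -
      have "?h m = ?h i" using that(1) unfolding N_def by blast
      from fun_cong[OF this, of x] that(2) show ?thesis by simp
    qed
    moreover have "infinite N" "N \<subseteq> A" using i(2) by (auto simp: N_def)
    ultimately have "P n N" unfolding P_def by metis
    with \<open>N \<subseteq> A\<close> show ?thesis by blast
  qed
  have "\<exists>A. \<forall>n. P n (A n) \<and> A (Suc n) \<subseteq> A n"
  proof (rule dependent_nat_choice)
    show "\<exists>A. P 0 A" using refine[OF infinite_UNIV_nat] by blast
    show "\<exists>B. P (Suc n) B \<and> B \<subseteq> A" if "P n A" for A n
      using refine that by (simp add: P_def)
  qed
  then obtain A where A: "\<And>n. P n (A n)" and Suc: "\<And>n. A (Suc n) \<subseteq> A n" by blast
  have anti: "A n \<subseteq> A m" if "m \<le> n" for m n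
    using Suc that by (rule lift_Suc_antimono_le)
  \<comment> \<open>The index used for \<open>g x\<close> must depend on \<open>x\<close> alone; the first stage that contains \<open>x\<close> will do.\<close>
  define k where "k x = (LEAST n. x \<in> D n)" for x
  define g where "g x = f (SOME i. i \<in> A (k x)) x" for x
  have "\<exists>m\<ge>n. \<forall>x\<in>D n. g x = f m x" for n
  proof -
    have "infinite (A n)" using A by (simp add: P_def)
    then obtain m where m: "m \<ge> n" "m \<in> A n" using infinite_nat_iff_unbounded_le by blast
    have "g x = f m x" if x: "x \<in> D n" for x
    proof -
      have k: "x \<in> D (k x)" "k x \<le> n" using x unfolding k_def by (rule LeastI, rule Least_le)
      have mk: "m \<in> A (k x)" using anti[OF k(2)] m(2) by blast
      then have "(SOME i. i \<in> A (k x)) \<in> A (k x)" by (rule someI)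
      then show ?thesis using A[of "k x"] mk k(1) unfolding P_def g_def by blast
    qed
    then show ?thesis using m(1) by blast
  qed
  then show thesis by (rule that)
qed

text \<open>A total pairing restricts to the positions with letters in \<open>I\<close> because partners carry inverse
  letters. Conversely, a limit of total pairings of the restrictions to \<open>{..<n}\<close> exists as
  there are finitely many positions with the letter inverse to that of \<open>x\<close>.\<close>

lemma total_pairing_compactness:
  assumes v: "is_word v"
  shows "(\<exists>f. pairing v (positions v) f) \<longleftrightarrow>
    (\<forall>I. finite I \<longrightarrow> (\<exists>f. pairing (restrict_letters v I) (positions (restrict_letters v I)) f))"
proof (intro iffI allI impI)
  fix I :: "nat set"
  assume "\<exists>f. pairing v (positions v) f"
  then obtain f where f: "pairing v (positions v) f" by blast
  note D = pairingD[OF f] and ivl = pairing_interval[OF f]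
  have closed: "letter_at v (f x) \<in> letters I \<longleftrightarrow> letter_at v x \<in> letters I"
    if "x \<in> positions v" for x
    using D(4)[OF that] by simp
  have "pairing (restrict_letters v I) (positions (restrict_letters v I)) f"
  proof (rule pairingI)
    fix x assume "x \<in> positions (restrict_letters v I)"
    then have x: "x \<in> positions v" "letter_at v x \<in> letters I" by simp_all
    show "f x \<in> positions (restrict_letters v I)" using D(2) closed x by simp
    show "f (f x) = x" using D(3)[OF x(1)] .
    show "letter_at (restrict_letters v I) (f x) = inv_letter (letter_at (restrict_letters v I) x)"
      using D(4)[OF x(1)] by simp
    fix z assume z: "(x, z) \<in> pos_le (restrict_letters v I)" "(z, f x) \<in> pos_le (restrict_letters v I)"
    then have z': "(x, z) \<in> pos_le v" "(z, f x) \<in> pos_le v" "z \<in> positions v" "letter_at v z \<in> letters I"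
      by simp_all
    show "z \<in> positions (restrict_letters v I) \<and> (x, f z) \<in> pos_le (restrict_letters v I) \<and>
        (f z, f x) \<in> pos_le (restrict_letters v I)"
      using ivl(2,3)[OF x(1) z'(1,2)] z'(3,4) x closed[OF x(1)] closed[OF z'(3)] D(2)[OF x(1)] D(2)[OF z'(3)]
      by simp
  qed simp
  then show "\<exists>f. pairing (restrict_letters v I) (positions (restrict_letters v I)) f" by blast
next
  assume loc: "\<forall>I. finite I \<longrightarrow>
    (\<exists>f. pairing (restrict_letters v I) (positions (restrict_letters v I)) f)"
  define S where "S n = positions (restrict_letters v {..<n})" for n :: nat
  have S_iff: "x \<in> S n \<longleftrightarrow> x \<in> positions v \<and> letter_at v x \<in> letters {..<n}" for x n
    by (simp add: S_def)
  have S_mono: "S m \<subseteq> S n" if "m \<le> n" for m n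
    using that by (auto simp: S_iff letters_def)
  have S_cover: "\<exists>n. x \<in> S n" if "x \<in> positions v" for x
    using that by (cases "letter_at v x") (auto simp: S_iff letters_def)
  have "\<exists>f. pairing (restrict_letters v {..<n}) (S n) f" for n
    using loc unfolding S_def by blast
  then obtain f where f: "\<And>n. pairing (restrict_letters v {..<n}) (S n) (f n)" by metis
  note D = pairingD[OF f]
  define C where "C x = {s \<in> positions v. letter_at v s = inv_letter (letter_at v x)}" for x
  obtain g where g: "\<And>n. \<exists>m\<ge>n. \<forall>x\<in>S n. g x = f m x"
  proof (rule finite_valued_limit[of S C f])
    show "finite (S n)" for n
      unfolding S_def using v by (rule finite_positions_restrict_letters) simp
    show "S m \<subseteq> S n" if "m \<le> n" for m n using that by (rule S_mono)
    show "finite (C x)" for x using v by (simp add: C_def is_word_def)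
    show "f n x \<in> C x" if "x \<in> S n" for n x
      using D(2,4)[OF that] by (simp add: C_def S_iff)
  qed (rule that)
  \<comment> \<open>A pairing is a condition on two positions and their partners, and these lie in a common finite
    stage where \<open>g\<close> agrees with a local pairing.\<close>
  have stage: "\<exists>m. x \<in> S m \<and> z \<in> S m \<and> g x = f m x \<and> g z = f m z \<and> g (f m x) = f m (f m x)"
    if x: "x \<in> positions v" and z: "z \<in> positions v" for x z
  proof -
    obtain i j where ij: "x \<in> S i" "z \<in> S j" using S_cover x z by blast
    then have n: "x \<in> S (max i j)" "z \<in> S (max i j)"
      using S_mono[of i "max i j"] S_mono[of j "max i j"] by auto
    obtain m where m: "m \<ge> max i j" "\<forall>x\<in>S (max i j). g x = f m x" using g by blast
    have S: "x \<in> S m" "z \<in> S m" using S_mono[OF m(1)] n by auto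
    have "f m x \<in> S (max i j)" using D(2,4)[OF S(1)] n(1) by (simp add: S_iff)
    then show ?thesis using S m(2) n by blast
  qed
  have "pairing v (positions v) g"
  proof (rule pairingI)
    fix x assume x: "x \<in> positions v"
    obtain m where m: "x \<in> S m" "g x = f m x" "g (f m x) = f m (f m x)"
      using stage[OF x x] by blast
    show "g x \<in> positions v" using D(2)[OF m(1)] m(2) by (simp add: S_iff)
    show "g (g x) = x" using D(3)[OF m(1)] m by simp
    show "letter_at v (g x) = inv_letter (letter_at v x)" using D(4)[OF m(1)] m(2) by simp
  next
    fix x z assume x: "x \<in> positions v" and xz: "(x, z) \<in> pos_le v" "(z, g x) \<in> pos_le v"
    have z: "z \<in> positions v"
      using position_field[OF _ xz(1)] v by (simp add: is_word_def)
    obtain m where m: "x \<in> S m" "z \<in> S m" "g x = f m x" "g z = f m z"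
      using stage[OF x z] by blast
    have S: "f m x \<in> S m" using D(2)[OF m(1)] .
    have "(x, z) \<in> pos_le (restrict_letters v {..<m})" "(z, f m x) \<in> pos_le (restrict_letters v {..<m})"
      using xz m S by (simp_all add: S_iff)
    from pairing_interval(2,3)[OF f m(1) this]
    show "z \<in> positions v \<and> (x, g z) \<in> pos_le v \<and> (g z, g x) \<in> pos_le v"
      using z m(3,4) by simp
  qed simp
  then show "\<exists>f. pairing v (positions v) f" by blast
qed

lemma is_word_quotient_word:
  assumes w: "is_word w" and w': "is_word w'"
  shows "is_word (quotient_word w w')"
  unfolding is_word_def
proof (intro conjI allI)
  show "countable (positions (quotient_word w w'))"
    using w w' by (simp add: quotient_word_def is_word_def)
  show "linear_order_on (positions (quotient_word w w')) (pos_le (quotient_word w w'))"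
    using w w' by (intro linear_order_quotient_word) (simp_all add: is_word_def)
  fix a
  have "{s \<in> positions (quotient_word w w'). letter_at (quotient_word w w') s = a} \<subseteq>
      Inl ` {x \<in> positions w. letter_at w x = a} \<union>
      Inr ` {y \<in> positions w'. letter_at w' y = inv_letter a}"
    by (auto simp: quotient_word_def)
  moreover have "finite {x \<in> positions w. letter_at w x = a}"
    "finite {y \<in> positions w'. letter_at w' y = inv_letter a}"
    using w w' by (simp_all add: is_word_def)
  ultimately show "finite {s \<in> positions (quotient_word w w'). letter_at (quotient_word w w') s = a}"
    by (meson finite_UnI finite_imageI finite_subset)
qed

lemma restrict_letters_quotient_word:
  "restrict_letters (quotient_word w w') I = quotient_word (restrict_letters w I) (restrict_letters w' I)"
proof (rule word.equality)
  show "positions (restrict_letters (quotient_word w w') I) =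
      positions (quotient_word (restrict_letters w I) (restrict_letters w' I))"
  proof (rule set_eqI)
    fix s show "s \<in> positions (restrict_letters (quotient_word w w') I) \<longleftrightarrow>
      s \<in> positions (quotient_word (restrict_letters w I) (restrict_letters w' I))"
      by (cases s) simp_all
  qed
  show "pos_le (restrict_letters (quotient_word w w') I) =
      pos_le (quotient_word (restrict_letters w I) (restrict_letters w' I))"
  proof (rule set_eqI)
    fix p show "p \<in> pos_le (restrict_letters (quotient_word w w') I) \<longleftrightarrow>
      p \<in> pos_le (quotient_word (restrict_letters w I) (restrict_letters w' I))"
      by (cases p; cases "fst p"; cases "snd p") auto
  qed
  show "letter_at (restrict_letters (quotient_word w w') I) =
      letter_at (quotient_word (restrict_letters w I) (restrict_letters w' I))"
    by (rule ext) (simp add: quotient_word_def)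
qed simp

section \<open>Existence of the reduced form\<close>

lemma restrict_word_positions:
  assumes "linear_order_on (positions v) (pos_le v)"
  shows "restrict_word v (positions v) = v"
  using position_field[OF assms] by (intro word.equality) (auto simp: restrict_word_def)

lemma reduces_to_refl:
  assumes "linear_order_on (positions v) (pos_le v)"
  shows "reduces_to v v"
proof -
  have "pairing v {} id" by (simp add: pairing_def)
  moreover have "restrict_word v (positions v - {}) = v"
    using restrict_word_positions[OF assms] by simp
  ultimately show ?thesis
    unfolding reduces_to_iff_pairing[OF assms] by metis
qed

text \<open>The arcs of both reductions together are again noncrossing: those of the second one join
  positions that survived the first one, so \<open>pairing_outside\<close> applies to them.\<close>

lemma reduces_to_trans:
  assumes lin: "linear_order_on (positions v) (pos_le v)"
    and vu: "reduces_to v u" and ut: "reduces_to u t"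
  shows "reduces_to v t"
proof -
  obtain D f where f: "pairing v D f" and u: "u = restrict_word v (positions v - D)"
    using vu reduces_to_iff_pairing[OF lin] by blast
  have lin_u: "linear_order_on (positions u) (pos_le u)"
    unfolding u using lin by (rule linear_order_restrict_word)
  obtain E h where h: "pairing u E h" and t: "t = restrict_word u (positions u - E)"
    using ut reduces_to_iff_pairing[OF lin_u] by blast
  have u_pos: "positions u = positions v - D" by (auto simp: u)
  note Df = pairingD[OF f] and Dh = pairingD[OF h]
  have E: "x \<in> positions v" "x \<notin> D" if "x \<in> E" for x
    using Dh(1)[OF that] by (simp_all add: u_pos)
  define k where "k x = (if x \<in> D then f x else h x)" for x
  have k_D: "k x = f x" if "x \<in> D" for x using that by (simp add: k_def)
  have k_E: "k x = h x" if "x \<in> E" for x using E(2)[OF that] by (simp add: k_def)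
  have "pairing v (D \<union> E) k"
  proof (rule pairingI)
    show "D \<union> E \<subseteq> positions v" using Df(1) E(1) by blast
    fix x assume x: "x \<in> D \<union> E"
    show "k x \<in> D \<union> E" using x Df(2) Dh(2) k_D k_E by (elim UnE) simp_all
    show "k (k x) = x" using x Df(2,3) Dh(2,3) k_D k_E by (elim UnE) simp_all
    show "letter_at v (k x) = inv_letter (letter_at v x)"
      using x Df(4) Dh(4) k_D k_E by (elim UnE) (simp_all add: u)
    fix z assume z: "(x, z) \<in> pos_le v" "(z, k x) \<in> pos_le v"
    from x show "z \<in> D \<union> E \<and> (x, k z) \<in> pos_le v \<and> (k z, k x) \<in> pos_le v"
    proof
      assume "x \<in> D"
      then show ?thesis
        using pairing_interval[OF f _ z(1)] z(2) by (simp add: k_D)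
    next
      assume x: "x \<in> E"
      show ?thesis
      proof (cases "z \<in> D")
        case True
        have "(x, f z) \<in> pos_le v" using lin f E[OF x] True z(1) by (rule pairing_above)
        moreover have "(f z, h x) \<in> pos_le v"
          using lin f E[OF Dh(2)[OF x]] True z(2)[unfolded k_E[OF x]] by (rule pairing_below)
        ultimately show ?thesis using True x by (simp add: k_D k_E)
      next
        case False
        have "z \<in> positions v" using position_field[OF lin z(1)] by blast
        then have "(x, z) \<in> pos_le u" "(z, h x) \<in> pos_le u"
          using z False x E[OF x] E[OF Dh(2)[OF x]] by (simp_all add: u k_E)
        from pairing_interval[OF h x this] show ?thesis using x by (simp add: k_E u)
      qed
    qed
  qed
  moreover have "t = restrict_word v (positions v - (D \<union> E))"
    unfolding t u by (rule word.equality) (auto simp: restrict_word_def)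
  ultimately show ?thesis unfolding reduces_to_iff_pairing[OF lin] by blast
qed

text \<open>A word that is not reduced has a reduction to fewer positions.\<close>

lemma reduced_form_exists:
  assumes "finite (positions v)" and "linear_order_on (positions v) (pos_le v)"
  shows "\<exists>u. reduces_to v u \<and> reduced u"
  using assms
proof (induction "card (positions v)" arbitrary: v rule: less_induct)
  case less
  show ?case
  proof (cases "reduced v")
    case True
    then show ?thesis using reduces_to_refl less.prems(2) by blast
  next
    case False
    then obtain R le where R: "reduction v R le" "R \<noteq> {}" by (auto simp: reduced_def)
    define u where "u = restrict_word v (positions v - \<Union>R)"
    have vu: "reduces_to v u" using R(1) by (auto simp: reduces_to_def u_def)
    obtain p where p: "p \<in> R" using R(2) by blast
    then obtain x where "x \<in> p" "x \<in> positions v"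
      using R(1) unfolding reduction_def by blast
    then have "positions u \<subset> positions v" using p by (auto simp: u_def)
    then have "card (positions u) < card (positions v)" "finite (positions u)"
      using less.prems(1) by (auto simp: psubset_card_mono intro: finite_subset)
    moreover have "linear_order_on (positions u) (pos_le u)"
      unfolding u_def using less.prems(2) by (rule linear_order_restrict_word)
    ultimately obtain t where "reduces_to u t" "reduced t" using less.hyps by blast
    then show ?thesis using reduces_to_trans[OF less.prems(2) vu] by blast
  qed
qed

lemma red_form_reduces:
  assumes "finite (positions v)" and "linear_order_on (positions v) (pos_le v)"
  shows "reduces_to v (red_form v)" and "reduced (red_form v)"
  using someI_ex[OF reduced_form_exists[OF assms]] by (simp_all add: red_form_def)

section \<open>Free reduction of lists\<close>

text \<open>Multiplication by \<open>a\<close> from the left in the free group, when the elements of that group are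
  represented by freely reduced lists.\<close>

definition cancel_cons :: "letter \<Rightarrow> letter list \<Rightarrow> letter list" where
  "cancel_cons a xs = (if xs \<noteq> [] \<and> hd xs = inv_letter a then tl xs else a # xs)"

definition free_reduce :: "letter list \<Rightarrow> letter list" where
  "free_reduce xs = foldr cancel_cons xs []"

abbreviation freely_reduced :: "letter list \<Rightarrow> bool" where
  "freely_reduced \<equiv> successively (\<lambda>a b. b \<noteq> inv_letter a)"

lemma freely_reduced_cancel_cons: "freely_reduced xs \<Longrightarrow> freely_reduced (cancel_cons a xs)"
  by (cases xs) (auto simp: cancel_cons_def successively_Cons)

lemma freely_reduced_free_reduce: "freely_reduced (free_reduce xs)"
  by (induction xs) (auto simp: free_reduce_def intro: freely_reduced_cancel_cons)

lemma cancel_cons_inverse: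
  "freely_reduced xs \<Longrightarrow> cancel_cons a (cancel_cons (inv_letter a) xs) = xs"
  by (cases xs) (auto simp: cancel_cons_def successively_Cons)

text \<open>Left multiplication by \<open>a\<close> undoes left multiplication by its inverse. This holds on freely
  reduced lists only, and \<open>free_reduce\<close> produces nothing else.\<close>

lemma free_reduce_cancel: "free_reduce (as @ a # inv_letter a # bs) = free_reduce (as @ bs)"
  using cancel_cons_inverse[OF freely_reduced_free_reduce, of a bs] by (simp add: free_reduce_def)

lemma free_reduce_neqE:
  assumes "free_reduce xs \<noteq> xs"
  obtains as a bs where "xs = as @ a # inv_letter a # bs"
  using assms
proof (induction xs arbitrary: thesis)
  case Nil
  then show ?case by (simp add: free_reduce_def)
next
  case (Cons x xs)
  show ?case
  proof (cases "free_reduce xs = xs")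
    case True
    then have "cancel_cons x xs \<noteq> x # xs" using Cons.prems(2) by (simp add: free_reduce_def)
    then have "xs \<noteq> []" "hd xs = inv_letter x" by (auto simp: cancel_cons_def split: if_splits)
    then have "x # xs = [] @ x # inv_letter x # tl xs" by (cases xs) simp_all
    then show ?thesis by (rule Cons.prems(1))
  next
    case False
    then obtain as a bs where "xs = as @ a # inv_letter a # bs" using Cons.IH by blast
    then have "x # xs = (x # as) @ a # inv_letter a # bs" by simp
    then show ?thesis by (rule Cons.prems(1))
  qed
qed

section \<open>Uniqueness of the reduced form\<close>

definition enumerates :: "'a list \<Rightarrow> 'a rel \<Rightarrow> 'a set \<Rightarrow> bool" where
  "enumerates ps r A \<longleftrightarrow> distinct ps \<and> set ps = A \<and> sorted_wrt (\<lambda>x y. (x, y) \<in> r) ps"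

text \<open>A new element \<open>x\<close> is inserted between the elements below it and the other ones.\<close>

lemma enumeration_exists:
  assumes r: "linear_order_on A r" and "finite B" "B \<subseteq> A"
  shows "\<exists>ps. enumerates ps r B"
  using assms(2,3)
proof (induction B)
  case empty
  have "enumerates [] r {}" by (simp add: enumerates_def)
  then show ?case by blast
next
  case (insert x B)
  then obtain ps where ps: "distinct ps" "set ps = B" "sorted_wrt (\<lambda>x y. (x, y) \<in> r) ps"
    by (auto simp: enumerates_def)
  have trans: "(a, c) \<in> r" if "(a, b) \<in> r" "(b, c) \<in> r" for a b c
    using r that unfolding order_on_defs by (blast dest: transD)
  have total: "(x, y) \<in> r" if "y \<in> B" "(y, x) \<notin> r" for y
  proof -
    have "total_on A r" using r by (simp add: linear_order_on_def)
    moreover have "x \<in> A" "y \<in> A" "x \<noteq> y" using that(1) insert.hyps insert.prems by auto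
    ultimately show ?thesis using that(2) unfolding total_on_def by blast
  qed
  let ?low = "filter (\<lambda>y. (y, x) \<in> r) ps" and ?high = "filter (\<lambda>y. (y, x) \<notin> r) ps"
  have low_high: "(y, z) \<in> r" if "y \<in> set ?low" "z \<in> set ?high" for y z
  proof -
    have "(y, x) \<in> r" "z \<in> B" "(z, x) \<notin> r" using that ps(2) by simp_all
    then show ?thesis using trans total by blast
  qed
  have x_high: "(x, z) \<in> r" if "z \<in> set ?high" for z
    using that total[of z] ps(2) by simp
  have "sorted_wrt (\<lambda>x y. (x, y) \<in> r) (?low @ x # ?high)"
    unfolding sorted_wrt_append sorted_wrt.simps(2)
  proof (intro conjI ballI sorted_wrt_filter ps(3))
    fix z assume "z \<in> set ?high" then show "(x, z) \<in> r" by (rule x_high)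
  next
    fix y z assume y: "y \<in> set ?low" and "z \<in> set (x # ?high)"
    then consider "z = x" | "z \<in> set ?high" by auto
    then show "(y, z) \<in> r" using low_high[OF y] y by cases simp_all
  qed
  then have "enumerates (?low @ x # ?high) r (insert x B)"
    using ps insert.hyps by (auto simp: enumerates_def)
  then show ?case by blast
qed

lemma enumeration_unique:
  assumes "antisym r" "enumerates ps r A" "enumerates qs r A"
  shows "ps = qs"
  using assms(2,3)
proof (induction ps arbitrary: qs A)
  case Nil
  then show ?case by (simp add: enumerates_def)
next
  case (Cons p ps)
  then obtain q qs' where qs: "qs = q # qs'" by (cases qs) (auto simp: enumerates_def)
  have "p = q"
  proof (rule ccontr)
    assume "p \<noteq> q"
    then have "(p, q) \<in> r" "(q, p) \<in> r"
      using Cons.prems unfolding qs enumerates_def by auto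
    then show False using assms(1) \<open>p \<noteq> q\<close> by (blast dest: antisymD)
  qed
  moreover have "enumerates ps r (A - {p})" "enumerates qs' r (A - {q})"
    using Cons.prems unfolding qs enumerates_def by auto
  ultimately show ?case using Cons.IH qs by blast
qed

lemma enumerates_filter:
  assumes "enumerates ps r A"
  shows "enumerates (filter P ps) r {x \<in> A. P x}"
  using assms by (auto simp: enumerates_def sorted_wrt_filter)

text \<open>Adjacency as in the definition of reductions does not say which of the two elements comes
  first, hence the two cases.\<close>

lemma enumerates_adjacent:
  assumes ps: "enumerates ps r A" and adj: "adjacent_in r A x y" and xy: "x \<noteq> y"
  obtains as bs where "ps = as @ x # y # bs" | as bs where "ps = as @ y # x # bs"
proof -
  have dist: "distinct ps" and sorted: "sorted_wrt (\<lambda>x y. (x, y) \<in> r) ps" and set: "set ps = A"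
    using ps by (auto simp: enumerates_def)
  have step: "cs = []"
    if "ps = as @ a # cs @ b # bs" "{a, b} = {x, y}" for as a cs b bs
  proof (rule ccontr)
    assume "cs \<noteq> []"
    then obtain c where c: "c \<in> set cs" by (cases cs) auto
    then have "(a, c) \<in> r" "(c, b) \<in> r" "c \<noteq> a" "c \<noteq> b" "c \<in> A"
      using dist sorted set unfolding that(1) by (auto simp: sorted_wrt_append)
    then show False using adj that(2) unfolding adjacent_in_def doubleton_eq_iff by blast
  qed
  have mem: "x \<in> set ps" "y \<in> set ps" using adj set by (auto simp: adjacent_in_def)
  obtain as bs where split: "ps = as @ x # bs" using split_list[OF mem(1)] by blast
  then consider "y \<in> set as" | "y \<in> set bs" using mem(2) xy by auto
  then show thesis
  proof cases
    case 1
    then obtain as' cs where "as = as' @ y # cs" using split_list by fast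
    then have "ps = as' @ y # cs @ x # bs" using split by simp
    with step[OF this] show ?thesis using that(2)[of as' bs] by (simp add: insert_commute)
  next
    case 2
    then obtain cs bs' where "bs = cs @ y # bs'" using split_list by fast
    then have "ps = as @ x # cs @ y # bs'" using split by simp
    with step[OF this] show ?thesis using that(1)[of as bs'] by simp
  qed
qed

text \<open>A finite reduction cancels its pairs one after the other, and each of them consists of
  neighbours in the list of what is left. So each step is an instance of \<open>free_reduce_cancel\<close>.\<close>

lemma free_reduce_invariant:
  assumes red: "reduction v R le" and ps: "enumerates ps (pos_le v) (positions v)"
  shows "free_reduce (map (letter_at v) (filter (\<lambda>x. x \<notin> \<Union>R) ps)) = free_reduce (map (letter_at v) ps)"
proof -
  let ?L = "letter_at v"
  have le: "linear_order_on R le" using red by (simp add: reduction_def)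
  have "finite (positions v)" using ps finite_set[of ps] by (simp add: enumerates_def)
  moreover have "R \<subseteq> Pow (positions v)"
  proof
    fix p assume "p \<in> R"
    then obtain x y where "p = {x, y}" "x \<in> positions v" "y \<in> positions v"
      using red unfolding reduction_def by metis
    then show "p \<in> Pow (positions v)" by simp
  qed
  ultimately have "finite R" by (meson finite_Pow_iff finite_subset)
  then obtain rs where rs: "distinct rs" "set rs = R" "sorted_wrt (\<lambda>p q. (p, q) \<in> le) rs"
    using enumeration_exists[OF le _ subset_refl] by (auto simp: enumerates_def)
  have "free_reduce (map ?L (filter (\<lambda>x. x \<notin> \<Union>(set (take k rs))) ps)) = free_reduce (map ?L ps)"
    if "k \<le> length rs" for k
    using that
  proof (induction k)
    case 0
    then show ?case by simp
  next
    case (Suc k)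
    let ?p = "rs ! k" and ?T = "\<Union>(set (take k rs))"
    have k: "k < length rs" using Suc.prems by simp
    have p: "?p \<in> R" using rs(2) k nth_mem by blast
    have "q \<in> set (take k rs) \<longleftrightarrow> (q, ?p) \<in> le \<and> q \<noteq> ?p" if q: "q \<in> R" for q
    proof -
      obtain j where j: "j < length rs" "q = rs ! j" using q rs(2) by (metis in_set_conv_nth)
      have "q \<in> set (take k rs) \<longleftrightarrow> j < k"
        using j k rs(1) by (auto simp: in_set_conv_nth nth_eq_iff_index_eq)
      moreover have "(q, ?p) \<in> le \<and> q \<noteq> ?p" if "j < k"
        using that j k rs(1) sorted_wrt_nth_less[OF rs(3) that k] by (simp add: nth_eq_iff_index_eq)
      moreover have "j < k" if *: "(q, ?p) \<in> le" "q \<noteq> ?p"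
      proof (rule ccontr)
        assume "\<not> j < k"
        then have "k < j" using *(2) j(2) by (cases "j = k") auto
        then have "(?p, q) \<in> le" using j sorted_wrt_nth_less[OF rs(3)] by simp
        then show False
          using * le unfolding linear_order_on_def partial_order_on_def by (blast dest: antisymD)
      qed
      ultimately show ?thesis by blast
    qed
    \<comment> \<open>The pairs cancelled before the \<open>k\<close>-th one are those listed before it.\<close>
    then have earlier: "{q \<in> R. (q, ?p) \<in> le \<and> q \<noteq> ?p} = set (take k rs)"
      using set_take_subset[of k rs] rs(2) by blast
    have "\<forall>p \<in> R. \<exists>x y. p = {x, y} \<and> x \<noteq> y \<and> x \<in> positions v \<and> y \<in> positions v \<and>
        adjacent_in (pos_le v) (positions v - \<Union>{q \<in> R. (q, p) \<in> le \<and> q \<noteq> p}) x y \<and>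
        letter_at v y = inv_letter (letter_at v x)"
      using red unfolding reduction_def by blast
    from bspec[OF this p, unfolded earlier]
    obtain x y where xy: "?p = {x, y}" "x \<noteq> y" "adjacent_in (pos_le v) (positions v - ?T) x y"
      "?L y = inv_letter (?L x)"
      by blast
    let ?qs = "filter (\<lambda>x. x \<notin> ?T) ps"
    have qs: "enumerates ?qs (pos_le v) (positions v - ?T)"
      using enumerates_filter[OF ps, of "\<lambda>x. x \<notin> ?T"] by (simp add: set_diff_eq)
    then have dist: "distinct ?qs" by (simp add: enumerates_def)
    have drop: "filter (\<lambda>z. z \<notin> {x, y}) ts = as @ bs"
      if ts: "ts = as @ a # b # bs" and "distinct ts" and ab: "{x, y} = {a, b}" for ts as bs a b
    proof -
      have "filter (\<lambda>z. z \<notin> {a, b}) as = as" "filter (\<lambda>z. z \<notin> {a, b}) bs = bs"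
        using that(2) unfolding ts by (intro filter_True; auto)+
      then show ?thesis unfolding ts ab by simp
    qed
    have "free_reduce (map ?L (filter (\<lambda>z. z \<notin> {x, y}) ?qs)) = free_reduce (map ?L ?qs)"
      using qs xy(3,2)
    proof (rule enumerates_adjacent)
      fix as bs assume eq: "?qs = as @ x # y # bs"
      show ?thesis
        unfolding drop[OF eq dist refl] unfolding eq
        using free_reduce_cancel[of "map ?L as" "?L x" "map ?L bs"] xy(4) by simp
    next
      fix as bs assume eq: "?qs = as @ y # x # bs"
      show ?thesis
        unfolding drop[OF eq dist insert_commute] unfolding eq
        using free_reduce_cancel[of "map ?L as" "?L y" "map ?L bs"] xy(4) by simp
    qed
    moreover have "filter (\<lambda>z. z \<notin> {x, y}) ?qs = filter (\<lambda>x. x \<notin> \<Union>(set (take (Suc k) rs))) ps"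
      using xy(1) k by (simp add: take_Suc_conv_app_nth conj_commute)
    ultimately show ?case using Suc by simp
  qed
  from this[of "length rs"] show ?thesis using rs(2) by simp
qed

definition spells :: "'a word \<Rightarrow> letter list \<Rightarrow> bool" where
  "spells v xs \<longleftrightarrow> (\<exists>ps. enumerates ps (pos_le v) (positions v) \<and> xs = map (letter_at v) ps)"

lemma spelling_exists:
  assumes "finite (positions v)" "linear_order_on (positions v) (pos_le v)"
  shows "\<exists>xs. spells v xs"
  using enumeration_exists[OF assms(2,1) subset_refl] by (auto simp: spells_def)

lemma spelling_unique:
  assumes "linear_order_on (positions v) (pos_le v)" "spells v xs" "spells v ys"
  shows "xs = ys"
  using assms enumeration_unique[of "pos_le v"]
  unfolding spells_def linear_order_on_def partial_order_on_def by metis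

lemma free_reduce_spelling_reduces_to:
  assumes vu: "reduces_to v u" and xs: "spells v xs"
  obtains ys where "spells u ys" "free_reduce ys = free_reduce xs"
proof -
  obtain R le where R: "reduction v R le" and u: "u = restrict_word v (positions v - \<Union>R)"
    using vu by (auto simp: reduces_to_def)
  obtain ps where ps: "enumerates ps (pos_le v) (positions v)" and xs_eq: "xs = map (letter_at v) ps"
    using xs by (auto simp: spells_def)
  let ?qs = "filter (\<lambda>x. x \<notin> \<Union>R) ps"
  have pos: "positions u = {x \<in> positions v. x \<notin> \<Union>R}" by (auto simp: u)
  have qs: "enumerates ?qs (pos_le v) (positions u)"
    using enumerates_filter[OF ps, of "\<lambda>x. x \<notin> \<Union>R"] by (simp only: pos)
  have "sorted_wrt (\<lambda>x y. (x, y) \<in> pos_le u) ?qs"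
  proof (rule sorted_wrt_mono_rel)
    show "sorted_wrt (\<lambda>x y. (x, y) \<in> pos_le v) ?qs" using qs by (simp add: enumerates_def)
    fix x y assume "x \<in> set ?qs" "y \<in> set ?qs" "(x, y) \<in> pos_le v"
    then show "(x, y) \<in> pos_le u" using ps by (auto simp: u enumerates_def)
  qed
  then have "enumerates ?qs (pos_le u) (positions u)" using qs by (simp add: enumerates_def)
  then have "spells u (map (letter_at v) ?qs)" by (auto simp: spells_def u)
  moreover have "free_reduce (map (letter_at v) ?qs) = free_reduce xs"
    using free_reduce_invariant[OF R ps] by (simp only: xs_eq)
  ultimately show thesis by (rule that)
qed

text \<open>If free reduction changes the list, there are neighbours with inverse letters, and
  cancelling just these two is a nonempty reduction.\<close>

lemma free_reduce_spelling_reduced: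
  assumes lin: "linear_order_on (positions u) (pos_le u)" and red: "reduced u" and xs: "spells u xs"
  shows "free_reduce xs = xs"
proof (rule ccontr)
  assume "free_reduce xs \<noteq> xs"
  then obtain as a bs where eq: "xs = as @ a # inv_letter a # bs" by (rule free_reduce_neqE)
  obtain ps where ps: "enumerates ps (pos_le u) (positions u)" and "xs = map (letter_at u) ps"
    using xs by (auto simp: spells_def)
  then have "map (letter_at u) ps = as @ a # inv_letter a # bs" using eq by simp
  then obtain as' x y bs' where split: "ps = as' @ x # y # bs'"
    and letters: "letter_at u x = a" "letter_at u y = inv_letter a"
    by (auto simp: map_eq_append_conv map_eq_Cons_conv)
  have set: "positions u = set as' \<union> {x, y} \<union> set bs'" and dist: "distinct (as' @ x # y # bs')"
    and sorted: "sorted_wrt (\<lambda>x y. (x, y) \<in> pos_le u) (as' @ x # y # bs')"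
    using ps unfolding enumerates_def split by auto
  note antisym = position_antisym[OF lin]
  have "False" if z: "z \<in> positions u" "z \<noteq> x" "z \<noteq> y"
    "(x, z) \<in> pos_le u \<and> (z, y) \<in> pos_le u \<or> (y, z) \<in> pos_le u \<and> (z, x) \<in> pos_le u" for z
  proof -
    have "z \<in> set as' \<or> z \<in> set bs'" using z set by blast
    then show False
    proof
      assume "z \<in> set as'"
      then have "(z, x) \<in> pos_le u" "(z, y) \<in> pos_le u" using sorted by (auto simp: sorted_wrt_append)
      then show False using antisym z by blast
    next
      assume "z \<in> set bs'"
      then have "(x, z) \<in> pos_le u" "(y, z) \<in> pos_le u" using sorted by (auto simp: sorted_wrt_append)
      then show False using antisym z by blast
    qed
  qed
  then have adj: "adjacent_in (pos_le u) (positions u) x y"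
    unfolding adjacent_in_def using set by blast
  let ?R = "{{x, y}}" and ?le = "{({x, y}, {x, y})}"
  have adj': "adjacent_in (pos_le u) (positions u - \<Union>{}) x y" using adj by simp
  have xy: "x \<noteq> y" "x \<in> positions u" "y \<in> positions u" "letter_at u y = inv_letter (letter_at u x)"
    using set dist letters by auto
  have none: "{q \<in> ?R. (q, {x, y}) \<in> ?le \<and> q \<noteq> {x, y}} = {}" by blast
  have "reduction u ?R ?le"
    unfolding reduction_def
  proof (intro conjI ballI)
    fix p assume "p \<in> ?R"
    then have p: "p = {x, y}" by simp
    show "\<exists>x y. p = {x, y} \<and> x \<noteq> y \<and> x \<in> positions u \<and> y \<in> positions u \<and>
        adjacent_in (pos_le u) (positions u - \<Union>{q \<in> ?R. (q, p) \<in> ?le \<and> q \<noteq> p}) x y \<and>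
        letter_at u y = inv_letter (letter_at u x)"
      unfolding p none using xy adj' by blast
  qed simp_all
  then show False using red by (auto simp: reduced_def)
qed

lemma spells_same_word:
  assumes same: "same_word u u'" and xs: "spells u xs"
  shows "spells u' xs"
proof -
  obtain \<phi> where bij: "bij_betw \<phi> (positions u) (positions u')"
    and le: "\<forall>x\<in>positions u. \<forall>y\<in>positions u. (x, y) \<in> pos_le u \<longleftrightarrow> (\<phi> x, \<phi> y) \<in> pos_le u'"
    and letters: "\<forall>x\<in>positions u. letter_at u x = letter_at u' (\<phi> x)"
    using same by (auto simp: same_word_def)
  obtain ps where ps: "enumerates ps (pos_le u) (positions u)" and xs_eq: "xs = map (letter_at u) ps"
    using xs by (auto simp: spells_def)
  then have set: "set ps = positions u" by (simp add: enumerates_def)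
  have "sorted_wrt (\<lambda>x y. (\<phi> x, \<phi> y) \<in> pos_le u') ps"
    by (rule sorted_wrt_mono_rel[of _ "\<lambda>x y. (x, y) \<in> pos_le u"])
      (use le set ps in \<open>auto simp: enumerates_def\<close>)
  then have "enumerates (map \<phi> ps) (pos_le u') (positions u')"
    using bij ps by (simp add: enumerates_def bij_betw_def distinct_map sorted_wrt_map)
  moreover have "xs = map (letter_at u') (map \<phi> ps)"
    using letters set by (simp add: xs_eq)
  ultimately show ?thesis by (auto simp: spells_def)
qed

lemma same_word_if_same_spelling:
  assumes lin: "linear_order_on (positions u) (pos_le u)"
    and lin': "linear_order_on (positions u') (pos_le u')"
    and xs: "spells u xs" "spells u' xs"
  shows "same_word u u'"
proof -
  obtain ps where ps: "enumerates ps (pos_le u) (positions u)" and eq: "xs = map (letter_at u) ps"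
    using xs(1) by (auto simp: spells_def)
  obtain qs where qs: "enumerates qs (pos_le u') (positions u')" and eq': "xs = map (letter_at u') qs"
    using xs(2) by (auto simp: spells_def)
  define N where "N = {..<length xs}"
  have len: "length ps = length xs" "length qs = length xs"
    using arg_cong[OF eq, of length] arg_cong[OF eq', of length] by simp_all
  have bij: "bij_betw ((!) ps) N (positions u)" "bij_betw ((!) qs) N (positions u')"
    using ps qs len by (auto simp: enumerates_def N_def intro!: bij_betw_nth)
  have nth_le: "(ts ! i, ts ! j) \<in> pos_le v \<longleftrightarrow> i \<le> j"
    if ts: "enumerates ts (pos_le v) (positions v)" and ij: "i < length ts" "j < length ts"
      and v: "linear_order_on (positions v) (pos_le v)"
    for ts i j and v :: "'c word"
  proof -
    have less: "(ts ! i, ts ! j) \<in> pos_le v" if "i < j" "j < length ts" for i j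
      using ts that sorted_wrt_nth_less[of "\<lambda>x y. (x, y) \<in> pos_le v" ts i j] by (simp add: enumerates_def)
    have "ts ! i \<in> positions v" using ts ij nth_mem by (auto simp: enumerates_def)
    then have refl: "(ts ! i, ts ! i) \<in> pos_le v" using position_refl[OF v] by blast
    have neq: "ts ! i \<noteq> ts ! j" if "i \<noteq> j"
      using ts ij that by (simp add: enumerates_def nth_eq_iff_index_eq)
    show ?thesis
      using less[of i j] less[of j i] refl neq position_antisym[OF v, of "ts ! i" "ts ! j"] ij
      by (cases i j rule: linorder_cases) auto
  qed
  define idx where "idx = inv_into N ((!) ps)"
  have idx: "idx x \<in> N" "ps ! idx x = x" if "x \<in> positions u" for x
    using that bij_betw_inv_into[OF bij(1)] bij_betw_inv_into_right[OF bij(1)]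
    by (auto simp: idx_def bij_betw_def)
  have "bij_betw (\<lambda>x. qs ! idx x) (positions u) (positions u')"
    using bij_betw_trans[OF bij_betw_inv_into[OF bij(1)] bij(2)] by (simp add: idx_def comp_def)
  moreover have "(x, y) \<in> pos_le u \<longleftrightarrow> (qs ! idx x, qs ! idx y) \<in> pos_le u'"
    if "x \<in> positions u" "y \<in> positions u" for x y
    using idx[OF that(1)] idx[OF that(2)] nth_le[OF ps _ _ lin, of "idx x" "idx y"]
      nth_le[OF qs _ _ lin', of "idx x" "idx y"] len by (simp add: N_def)
  moreover have "letter_at u x = letter_at u' (qs ! idx x)" if "x \<in> positions u" for x
  proof -
    have "map (letter_at u) ps ! idx x = map (letter_at u') qs ! idx x" using eq eq' by simp
    then show ?thesis using idx[OF that] len by (simp add: N_def)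
  qed
  ultimately show ?thesis
    unfolding same_word_def by (intro exI[of _ "\<lambda>x. qs ! idx x"]) blast
qed

text \<open>Given a common reduction, the invariance of free reduction shows that both reduced forms are
  spelled by the free reduction of the list that spells the common word.\<close>

lemma same_red_form_iff_common_reduction:
  assumes fin: "finite (positions v)" and lin: "linear_order_on (positions v) (pos_le v)"
    and fin': "finite (positions v')" and lin': "linear_order_on (positions v') (pos_le v')"
  shows "same_word (red_form v) (red_form v') \<longleftrightarrow>
    (\<exists>u u'. reduces_to v u \<and> reduces_to v' u' \<and> same_word u u')"
proof
  assume "same_word (red_form v) (red_form v')"
  then show "\<exists>u u'. reduces_to v u \<and> reduces_to v' u' \<and> same_word u u'"
    using red_form_reduces[OF fin lin] red_form_reduces[OF fin' lin'] by blast
next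
  have lin_reduct: "linear_order_on (positions u) (pos_le u)"
    if "reduces_to v u" "linear_order_on (positions v) (pos_le v)" for u v :: "'c word"
    using that linear_order_restrict_word by (auto simp: reduces_to_def)
  have spelling_red_form: "spells (red_form v) (free_reduce xs)"
    if fin: "finite (positions v)" and lin: "linear_order_on (positions v) (pos_le v)" and xs: "spells v xs"
    for v :: "'c word" and xs
  proof -
    note red = red_form_reduces[OF fin lin]
    obtain zs where zs: "spells (red_form v) zs" "free_reduce zs = free_reduce xs"
      using red(1) xs by (rule free_reduce_spelling_reduces_to)
    have "free_reduce zs = zs"
      using lin_reduct[OF red(1) lin] red(2) zs(1) by (rule free_reduce_spelling_reduced)
    then show ?thesis using zs by simp
  qed
  assume "\<exists>u u'. reduces_to v u \<and> reduces_to v' u' \<and> same_word u u'"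
  then obtain u u' where u: "reduces_to v u" and u': "reduces_to v' u'" and same: "same_word u u'"
    by blast
  obtain xs xs' where xs: "spells v xs" and xs': "spells v' xs'"
    using spelling_exists[OF fin lin] spelling_exists[OF fin' lin'] by blast
  obtain ys where ys: "spells u ys" "free_reduce ys = free_reduce xs"
    using u xs by (rule free_reduce_spelling_reduces_to)
  obtain ys' where ys': "spells u' ys'" "free_reduce ys' = free_reduce xs'"
    using u' xs' by (rule free_reduce_spelling_reduces_to)
  have "ys = ys'"
    using lin_reduct[OF u' lin'] spells_same_word[OF same ys(1)] ys'(1) by (rule spelling_unique)
  then have "free_reduce xs = free_reduce xs'" using ys(2) ys'(2) by simp
  then show "same_word (red_form v) (red_form v')"
    using spelling_red_form[OF fin lin xs] spelling_red_form[OF fin' lin' xs']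
      lin_reduct[OF red_form_reduces(1)[OF fin lin] lin]
      lin_reduct[OF red_form_reduces(1)[OF fin' lin'] lin']
    by (metis same_word_if_same_spelling)
qed

theorem lemma12:
  fixes w :: "'a word" and w' :: "'b word"
  assumes "is_word w" and "is_word w'"
  shows "(\<exists>u u'. reduces_to w u \<and> reduces_to w' u' \<and> same_word u u') \<longleftrightarrow>
         (\<forall>I :: nat set. finite I \<longrightarrow>
            same_word (red_form (restrict_letters w I)) (red_form (restrict_letters w' I)))"
proof -
  let ?Q = quotient_word
  have lin: "linear_order_on (positions w) (pos_le w)" "linear_order_on (positions w') (pos_le w')"
    using assms by (simp_all add: is_word_def)
  have local: "(\<exists>F. pairing (restrict_letters (?Q w w') I) (positions (restrict_letters (?Q w w') I)) F)
      \<longleftrightarrow> same_word (red_form (restrict_letters w I)) (red_form (restrict_letters w' I))"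
    if I: "finite I" for I
  proof -
    note linI = linear_order_restrict_letters[OF lin(1), of I] linear_order_restrict_letters[OF lin(2), of I]
    note finI = finite_positions_restrict_letters[OF assms(1) I] finite_positions_restrict_letters[OF assms(2) I]
    show ?thesis
      unfolding restrict_letters_quotient_word
      using common_reduction_iff_quotient_pairing[OF linI]
        same_red_form_iff_common_reduction[OF finI(1) linI(1) finI(2) linI(2)]
      by (rule trans[OF sym sym])
  qed
  have "(\<exists>u u'. reduces_to w u \<and> reduces_to w' u' \<and> same_word u u') \<longleftrightarrow>
      (\<exists>F. pairing (?Q w w') (positions (?Q w w')) F)"
    using lin by (rule common_reduction_iff_quotient_pairing)
  also have "\<dots> \<longleftrightarrow> (\<forall>I. finite I \<longrightarrow>
      (\<exists>F. pairing (restrict_letters (?Q w w') I) (positions (restrict_letters (?Q w w') I)) F))"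
    using is_word_quotient_word[OF assms] by (rule total_pairing_compactness)
  also have "\<dots> \<longleftrightarrow> (\<forall>I. finite I \<longrightarrow>
      same_word (red_form (restrict_letters w I)) (red_form (restrict_letters w' I)))"
    using local by blast
  finally show ?thesis .
qed

end
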